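(* Let $K\to K'$ be an algebraically pure morphism of fields and $x=(x_1,\ldots,x_n)$. Let $J_1,\ldots,J_p$ be subsets of $\{1,\ldots,n\}$, $x_{J_i}=(x_k)_{k\in J_i}$, and let $A_i=K\langle x_{J_i}\rangle$, resp. $A'_i=K'\langle x_{J_i}\rangle$, be the rings of algebraic power series in $x_{J_i}$ over $K$, resp. $K'$. Set $\mathcal{N}=A_1\times\cdots\times A_p$ and $\mathcal{N}'=A'_1\times\cdots\times A'_p$. Let $f$ be a finite system of polynomials in $K\langle x\rangle[Y]$, $Y=(Y_1,\ldots,Y_p)$, and let $\hat y\in\mathcal{N}'$ satisfy $f(\hat y)=0$ (in $K'\langle x\rangle$). Then there exists $y\in\mathcal{N}$ such that $f(y)=0$ and $\operatorname{ord} y_i=\operatorname{ord}\hat y_i$ for all $i\in\{1,\ldots,p\}$.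
   Context: A ring morphism $A\to B$ is called algebraically pure if every finite system of polynomial equations over $A$ which has a solution in $B$ also has a solution in $A$. For a field $K$ and variables $z=(z_1,\ldots,z_m)$, $K\langle z\rangle$ denotes the ring of algebraic power series, i.e. the set of formal power series in $K[[z]]$ that are algebraic over the polynomial ring $K[z]$. For a power series $g$, $\operatorname{ord} g$ is the least total degree of a monomial appearing in $g$ with nonzero coefficient ($\operatorname{ord}0=\infty$). *)

theory Defs
  imports Main "HOL-Library.Extended_Nat"
begin

definition field_hom :: "('a::field \<Rightarrow> 'b::field) \<Rightarrow> bool" where
  "field_hom \<phi> \<longleftrightarrow> \<phi> 1 = 1 \<and> (\<forall>a b. \<phi> (a + b) = \<phi> a + \<phi> b) \<and> (\<forall>a b. \<phi> (a * b) = \<phi> a * \<phi> b)"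

text \<open>Multivariate polynomials over a ring: coefficient functions on exponent vectors
  (nat \<Rightarrow> nat), with finite support consisting of finitely supported exponent vectors.
  Variables are indexed by nat.\<close>

definition mpoly :: "((nat \<Rightarrow> nat) \<Rightarrow> 'a::zero) \<Rightarrow> bool" where
  "mpoly P \<longleftrightarrow> finite {\<alpha>. P \<alpha> \<noteq> 0} \<and> (\<forall>\<alpha>. P \<alpha> \<noteq> 0 \<longrightarrow> finite {i. \<alpha> i \<noteq> 0})"

definition mpoly_eval :: "((nat \<Rightarrow> nat) \<Rightarrow> 'a::comm_ring_1) \<Rightarrow> (nat \<Rightarrow> 'a) \<Rightarrow> 'a" where
  "mpoly_eval P z = (\<Sum>\<alpha> | P \<alpha> \<noteq> 0. P \<alpha> * (\<Prod>i | \<alpha> i \<noteq> 0. z i ^ \<alpha> i))"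

definition alg_pure :: "('a::field \<Rightarrow> 'b::field) \<Rightarrow> bool" where
  "alg_pure \<phi> \<longleftrightarrow>
     (\<forall>(F :: nat \<Rightarrow> (nat \<Rightarrow> nat) \<Rightarrow> 'a) (q::nat).
        (\<forall>k<q. mpoly (F k)) \<longrightarrow>
        (\<exists>z'::nat \<Rightarrow> 'b. \<forall>k<q. mpoly_eval (\<phi> \<circ> F k) z' = 0) \<longrightarrow>
        (\<exists>z::nat \<Rightarrow> 'a. \<forall>k<q. mpoly_eval (F k) z = 0))"

text \<open>A formal power series is a coefficient function on exponent vectors.\<close>

type_synonym 'a ps = "(nat \<Rightarrow> nat) \<Rightarrow> 'a"

definition ps_zero :: "'a::zero ps" where
  "ps_zero = (\<lambda>_. 0)"

definition ps_one :: "'a::{zero,one} ps" where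
  "ps_one = (\<lambda>\<alpha>. if \<alpha> = (\<lambda>_. 0) then 1 else 0)"

definition ps_add :: "'a::plus ps \<Rightarrow> 'a ps \<Rightarrow> 'a ps" where
  "ps_add g h = (\<lambda>\<alpha>. g \<alpha> + h \<alpha>)"

text \<open>Cauchy product (finite sum for finitely supported exponent vectors).\<close>
definition ps_mult :: "'a::comm_ring_1 ps \<Rightarrow> 'a ps \<Rightarrow> 'a ps" where
  "ps_mult g h = (\<lambda>\<alpha>. \<Sum>\<beta> | \<forall>i. \<beta> i \<le> \<alpha> i. g \<beta> * h (\<lambda>i. \<alpha> i - \<beta> i))"

primrec ps_pow :: "'a::comm_ring_1 ps \<Rightarrow> nat \<Rightarrow> 'a ps" where
  "ps_pow g 0 = ps_one"
| "ps_pow g (Suc k) = ps_mult (ps_pow g k) g"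

definition ps_in :: "nat set \<Rightarrow> 'a::zero ps \<Rightarrow> bool" where
  "ps_in J g \<longleftrightarrow> (\<forall>\<alpha>. g \<alpha> \<noteq> 0 \<longrightarrow> (\<forall>i. i \<notin> J \<longrightarrow> \<alpha> i = 0))"

definition poly_in :: "nat set \<Rightarrow> 'a::zero ps \<Rightarrow> bool" where
  "poly_in J g \<longleftrightarrow> ps_in J g \<and> finite {\<alpha>. g \<alpha> \<noteq> 0}"

definition alg_ps :: "nat set \<Rightarrow> 'a::comm_ring_1 ps \<Rightarrow> bool" where
  "alg_ps J g \<longleftrightarrow> ps_in J g \<and>
     (\<exists>(d::nat) (c :: nat \<Rightarrow> 'a ps).
        (\<forall>j\<le>d. poly_in J (c j)) \<and> (\<exists>j\<le>d. c j \<noteq> ps_zero) \<and>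
        (\<lambda>\<alpha>. \<Sum>j\<le>d. ps_mult (c j) (ps_pow g j) \<alpha>) = ps_zero)"

definition ps_ord :: "nat \<Rightarrow> 'a::zero ps \<Rightarrow> enat" where
  "ps_ord n g = (if g = ps_zero then \<infinity>
                 else enat (LEAST d. \<exists>\<alpha>. g \<alpha> \<noteq> 0 \<and> (\<Sum>i<n. \<alpha> i) = d))"

primrec ps_mono_eval :: "nat \<Rightarrow> 'a::comm_ring_1 ps list \<Rightarrow> (nat \<Rightarrow> nat) \<Rightarrow> 'a ps" where
  "ps_mono_eval 0 y \<beta> = ps_one"
| "ps_mono_eval (Suc i) y \<beta> = ps_mult (ps_mono_eval i y \<beta>) (ps_pow (y ! i) (\<beta> i))"

definition ypoly :: "nat \<Rightarrow> ((nat \<Rightarrow> nat) \<Rightarrow> 'a::zero ps) \<Rightarrow> bool" where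
  "ypoly p F \<longleftrightarrow> finite {\<beta>. F \<beta> \<noteq> ps_zero} \<and>
                 (\<forall>\<beta>. F \<beta> \<noteq> ps_zero \<longrightarrow> (\<forall>i\<ge>p. \<beta> i = 0))"

definition ypoly_eval :: "nat \<Rightarrow> ((nat \<Rightarrow> nat) \<Rightarrow> 'a::comm_ring_1 ps) \<Rightarrow> 'a ps list \<Rightarrow> 'a ps" where
  "ypoly_eval p F y = (\<lambda>\<alpha>. \<Sum>\<beta> | F \<beta> \<noteq> ps_zero. ps_mult (F \<beta>) (ps_mono_eval p y \<beta>) \<alpha>)"

end

theory Submission
  imports Defs "HOL-Computational_Algebra.Polynomial" "HOL-Library.Infinite_Set"
begin

text \<open>The coefficients of an algebraic power series \<open>g\<close> over a field lie in a finitely generated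
  subring: \<open>g\<close> is a simple root of some polynomial \<open>P\<close> (in characteristic \<open>p\<close>, because \<open>P\<close>
  of minimal degree cannot be a polynomial in \<open>Z\<^bsup>p\<^esup>\<close>), and Newton's recursion then expresses all
  coefficients of \<open>g\<close> through those of \<open>P\<close>, finitely many coefficients of \<open>g\<close> and the inverse of
  the lowest coefficient of \<open>P'(g)\<close>. Purity of \<open>K \<rightarrow> K'\<close> means that every finitely generated
  \<open>K\<close>-subalgebra \<open>R\<close> of \<open>K'\<close> has a \<open>K\<close>-homomorphism \<open>R \<rightarrow> K\<close>. Applied to the
  coefficients of the given solution, it yields a solution over \<open>K\<close>. Inverses of finitely many
  elements are put into \<open>R\<close> to keep the orders and the annihilating polynomials nonzero.\<close>

section \<open>The ring of finitely supported power series\<close>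

text \<open>The unknown \<open>y\<close> consists of infinitely many coefficients tied by infinitely
  many equations, whereas purity solves finite systems only. A homomorphism on a finitely generated
  algebra bridges the gap, since it transports all equations at once. To exist, it must respect
  every relation among the generators. In place of a finite basis of the relation ideal it is enough
  to have finitely many relations that control all others wherever one further expression does not
  vanish; this non-vanishing costs a single extra unknown in the system handed to purity. On the
  side of the power series, K' may be imperfect, so an annihilator in Z^p has no p-th root to pass
  to. Newton's recursion also needs a monomial order in which each exponent has finitely many
  predecessors, because all coefficients up to a certain exponent become generators.\<close>

definition finsupp :: "(nat \<Rightarrow> nat) \<Rightarrow> bool" where
  "finsupp \<alpha> \<longleftrightarrow> finite {i. \<alpha> i \<noteq> 0}"

lemma finsupp_zero [simp]: "finsupp (\<lambda>_. 0)"
  by (simp add: finsupp_def)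

lemma finsupp_add_iff: "finsupp (\<lambda>i. \<alpha> i + \<beta> i) \<longleftrightarrow> finsupp \<alpha> \<and> finsupp \<beta>"
proof -
  have "{i. \<alpha> i + \<beta> i \<noteq> 0} = {i. \<alpha> i \<noteq> 0} \<union> {i. \<beta> i \<noteq> 0}" by auto
  then show ?thesis by (simp add: finsupp_def)
qed

lemma finsupp_mono: "finsupp \<alpha> \<Longrightarrow> \<beta> \<le> \<alpha> \<Longrightarrow> finsupp \<beta>"
  unfolding finsupp_def by (rule finite_subset[rotated]) (auto simp: le_fun_def intro: less_le_trans)

lemma finite_atMost_fun: "finsupp \<alpha> \<Longrightarrow> finite {\<beta>. \<forall>i. \<beta> i \<le> (\<alpha> i :: nat)}"
proof -
  assume "finsupp \<alpha>"
  then have S: "finite {i. \<alpha> i \<noteq> 0}" by (simp add: finsupp_def)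
  define m where "m = Max (\<alpha> ` {i. \<alpha> i \<noteq> 0})"
  have "finite {\<beta>. \<forall>i. (i \<in> {i. \<alpha> i \<noteq> 0} \<longrightarrow> \<beta> i \<in> {..m}) \<and> (i \<notin> {i. \<alpha> i \<noteq> 0} \<longrightarrow> \<beta> i = 0)}"
    using S by (rule finite_set_of_finite_funs) simp
  moreover have "\<alpha> i \<le> m" if "\<alpha> i \<noteq> 0" for i
    using S that by (simp add: m_def)
  then have "{\<beta>. \<forall>i. \<beta> i \<le> \<alpha> i} \<subseteq>
      {\<beta>. \<forall>i. (i \<in> {i. \<alpha> i \<noteq> 0} \<longrightarrow> \<beta> i \<in> {..m}) \<and> (i \<notin> {i. \<alpha> i \<noteq> 0} \<longrightarrow> \<beta> i = 0)}"
    by clarsimp (metis le_trans le_zero_eq)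
  ultimately show ?thesis by (rule rev_finite_subset)
qed

lemma infinite_atMost_fun:
  assumes "\<not> finsupp \<alpha>"
  shows "infinite {\<beta>. \<forall>i. \<beta> i \<le> (\<alpha> i :: nat)}"
proof
  assume fin: "finite {\<beta>. \<forall>i. \<beta> i \<le> \<alpha> i}"
  define e where "e = (\<lambda>k i :: nat. if i = k then 1 else 0 :: nat)"
  have "inj e" by (rule injI) (metis e_def zero_neq_one)
  moreover have "e ` {i. \<alpha> i \<noteq> 0} \<subseteq> {\<beta>. \<forall>i. \<beta> i \<le> \<alpha> i}"
    by (auto simp: e_def Suc_le_eq)
  then have "finite (e ` {i. \<alpha> i \<noteq> 0})" using fin by (rule finite_subset)
  ultimately have "finite {i. \<alpha> i \<noteq> 0}"
    by (simp add: finite_image_iff inj_on_subset[OF _ subset_UNIV])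
  then show False using assms by (simp add: finsupp_def)
qed

text \<open>On all coefficient functions \<open>ps_one\<close> is not neutral, because the product
  loses coefficients at exponents of infinite support. Without these exponents the series form a
  commutative ring, and powers, characteristic and the freshman's dream become available.\<close>

typedef (overloaded) 'a mps = "{g :: 'a::zero ps. \<forall>\<alpha>. g \<alpha> \<noteq> 0 \<longrightarrow> finsupp \<alpha>}"
  morphisms cf Mps
  by (rule exI[of _ "\<lambda>_. 0"]) auto

setup_lifting type_definition_mps

lemma cf_nonzeroD: "cf g \<alpha> \<noteq> 0 \<Longrightarrow> finsupp \<alpha>"
  using cf[of g] by simp

lemma cf_eq_0: "\<not> finsupp \<alpha> \<Longrightarrow> cf g \<alpha> = 0"
  using cf_nonzeroD by blast

text \<open>A sum over an infinite set is 0 by convention, so every product is supported on finitely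
  supported exponents.\<close>

lemma ps_mult_infinite: "\<not> finsupp \<alpha> \<Longrightarrow> ps_mult g h \<alpha> = 0"
  using infinite_atMost_fun by (simp add: ps_mult_def)

lemma ps_mult_commute: "ps_mult g h = ps_mult h g"
proof
  fix \<alpha>
  show "ps_mult g h \<alpha> = ps_mult h g \<alpha>"
    unfolding ps_mult_def
    by (rule sum.reindex_bij_witness[of _ "\<lambda>\<beta> i. \<alpha> i - \<beta> i" "\<lambda>\<beta> i. \<alpha> i - \<beta> i"])
       (auto simp: mult.commute)
qed

lemma ps_mult_assoc: "ps_mult (ps_mult f g) h = ps_mult f (ps_mult g h)"
proof
  fix \<alpha> :: "nat \<Rightarrow> nat"
  show "ps_mult (ps_mult f g) h \<alpha> = ps_mult f (ps_mult g h) \<alpha>"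
  proof (cases "finsupp \<alpha>")
    case True
    have fin: "finite {\<gamma>. \<forall>i. \<gamma> i \<le> \<alpha> i - \<beta> i}" "finite {\<gamma>. \<forall>i. \<gamma> i \<le> \<alpha> i}" for \<beta>
      using True finsupp_mono[OF True, of "\<lambda>i. \<alpha> i - \<beta> i"]
      by (auto intro!: finite_atMost_fun simp: le_fun_def)
    have fin': "finite {\<gamma>. \<forall>i. \<gamma> i \<le> \<beta> i}" if "\<forall>i. \<beta> i \<le> \<alpha> i" for \<beta>
      using that finsupp_mono[OF True, of \<beta>]
      by (auto intro!: finite_atMost_fun simp: le_fun_def)
    have "ps_mult (ps_mult f g) h \<alpha> =
      (\<Sum>\<delta> | \<forall>i. \<delta> i \<le> \<alpha> i. \<Sum>\<beta> | \<forall>i. \<beta> i \<le> \<delta> i. f \<beta> * g (\<lambda>i. \<delta> i - \<beta> i) * h (\<lambda>i. \<alpha> i - \<delta> i))"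
      by (simp add: ps_mult_def sum_distrib_right)
    also have "\<dots> = (\<Sum>(\<delta>, \<beta>) \<in> (SIGMA \<delta>:{\<delta>. \<forall>i. \<delta> i \<le> \<alpha> i}. {\<beta>. \<forall>i. \<beta> i \<le> \<delta> i}).
                       f \<beta> * g (\<lambda>i. \<delta> i - \<beta> i) * h (\<lambda>i. \<alpha> i - \<delta> i))"
      using fin fin' by (subst sum.Sigma) auto
    \<comment> \<open>Both double sums run over the splittings of \<alpha> into three exponents;
      \<open>(\<delta>, \<beta>)\<close> corresponds to
      \<open>(\<beta>, \<delta> - \<beta>)\<close>.\<close>
    also have "\<dots> = (\<Sum>(\<beta>, \<gamma>) \<in> (SIGMA \<beta>:{\<beta>. \<forall>i. \<beta> i \<le> \<alpha> i}. {\<gamma>. \<forall>i. \<gamma> i \<le> \<alpha> i - \<beta> i}).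
                       f \<beta> * (g \<gamma> * h (\<lambda>i. \<alpha> i - \<beta> i - \<gamma> i)))"
    proof (rule sum.reindex_bij_witness[of _ "\<lambda>(\<beta>, \<gamma>). (\<lambda>i. \<beta> i + \<gamma> i, \<beta>)"
            "\<lambda>(\<delta>, \<beta>). (\<beta>, \<lambda>i. \<delta> i - \<beta> i)"], goal_cases)
      case (1 a) then show ?case by (auto simp: fun_eq_iff)
    next
      case (2 a) then show ?case by (auto intro: order.trans) (meson diff_le_mono)
    next
      case (3 b) then show ?case by (auto simp: fun_eq_iff)
    next
      case (4 b)
      then show ?case by auto (metis Nat.le_diff_conv2 add.commute)
    next
      case (5 a) then show ?case by (auto simp: mult.assoc)
    qed
    also have "\<dots> = ps_mult f (ps_mult g h) \<alpha>"
      using fin by (subst sum.Sigma[symmetric]) (auto simp: ps_mult_def sum_distrib_left)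
    finally show ?thesis .
  qed (simp add: ps_mult_infinite)
qed

lemma ps_mult_one_left:
  assumes "\<And>\<alpha>. g \<alpha> \<noteq> 0 \<Longrightarrow> finsupp \<alpha>"
  shows "ps_mult ps_one g = g"
proof
  fix \<alpha>
  show "ps_mult ps_one g \<alpha> = g \<alpha>"
  proof (cases "finsupp \<alpha>")
    case True
    have "ps_mult ps_one g \<alpha> = (\<Sum>\<beta> | \<forall>i. \<beta> i \<le> \<alpha> i. if \<beta> = (\<lambda>_. 0) then g \<alpha> else 0)"
      unfolding ps_mult_def by (rule sum.cong) (auto simp: ps_one_def)
    then show ?thesis using finite_atMost_fun[OF True] by (simp add: sum.delta')
  next
    case False
    then show ?thesis using assms[of \<alpha>] by (auto simp: ps_mult_infinite)
  qed
qed

instantiation mps :: (comm_ring_1) comm_ring_1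
begin

lift_definition zero_mps :: "'a mps" is "\<lambda>_. 0" by simp
lift_definition one_mps :: "'a mps" is ps_one by (auto simp: ps_one_def split: if_splits)
lift_definition plus_mps :: "'a mps \<Rightarrow> 'a mps \<Rightarrow> 'a mps" is "\<lambda>g h \<alpha>. g \<alpha> + h \<alpha>"
  by (metis add.left_neutral)
lift_definition minus_mps :: "'a mps \<Rightarrow> 'a mps \<Rightarrow> 'a mps" is "\<lambda>g h \<alpha>. g \<alpha> - h \<alpha>"
  by (metis diff_0_right)
lift_definition uminus_mps :: "'a mps \<Rightarrow> 'a mps" is "\<lambda>g \<alpha>. - g \<alpha>" by simp
lift_definition times_mps :: "'a mps \<Rightarrow> 'a mps \<Rightarrow> 'a mps" is ps_mult
  using ps_mult_infinite by blast

instance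
proof
  fix a b c :: "'a mps"
  show "a * b * c = a * (b * c)" by transfer (rule ps_mult_assoc)
  show "a * b = b * a" by transfer (rule ps_mult_commute)
  show "1 * a = a" by transfer (rule ps_mult_one_left, blast)
  show "(a + b) * c = a * c + b * c"
    by transfer (simp add: ps_mult_def sum.distrib distrib_right)
  show "0 \<noteq> (1 :: 'a mps)"
    by transfer (auto simp: ps_one_def fun_eq_iff)
qed (transfer, simp add: algebra_simps)+

end

lemma cf_zero [simp]: "cf 0 \<alpha> = 0" by transfer simp
lemma cf_add [simp]: "cf (g + h) \<alpha> = cf g \<alpha> + cf h \<alpha>" by transfer simp
lemma cf_diff [simp]: "cf (g - h) \<alpha> = cf g \<alpha> - cf h \<alpha>" by transfer simp

lemma cf_one: "cf 1 \<alpha> = (if \<alpha> = (\<lambda>_. 0) then 1 else 0)"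
  by transfer (simp add: ps_one_def)

lemma cf_mult: "cf (g * h) \<alpha> = (\<Sum>\<beta> | \<forall>i. \<beta> i \<le> \<alpha> i. cf g \<beta> * cf h (\<lambda>i. \<alpha> i - \<beta> i))"
  by transfer (simp add: ps_mult_def)

lemma cf_sum: "cf (sum g A) \<alpha> = (\<Sum>x\<in>A. cf (g x) \<alpha>)"
  by (induct A rule: infinite_finite_induct) auto

lemma cf_power: "cf (g ^ k) = ps_pow (cf g) k"
proof (induct k)
  case 0 show ?case by (simp add: one_mps.rep_eq)
next
  case (Suc k) then show ?case
    by (simp add: power_Suc2 times_mps.rep_eq del: power_Suc)
qed

lemma mps_eqI: "(\<And>\<alpha>. finsupp \<alpha> \<Longrightarrow> cf g \<alpha> = cf h \<alpha>) \<Longrightarrow> g = h"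
  by (metis cf_eq_0 cf_inject ext)

lemma cf_of_nat_mult: "cf (of_nat k * g) \<alpha> = of_nat k * cf g \<alpha>"
  by (induct k) (auto simp: distrib_right)

lemma CHAR_mps: "CHAR('a::comm_ring_1 mps) = CHAR('a)"
proof (rule CHAR_eqI)
  show "of_nat CHAR('a) = (0 :: 'a mps)"
    by (rule mps_eqI) (use cf_of_nat_mult[of _ "1 :: 'a mps"] in simp)
  show "CHAR('a) dvd k" if "of_nat k = (0 :: 'a mps)" for k
    using arg_cong[OF that, of "\<lambda>g. cf g (\<lambda>_. 0)"] cf_of_nat_mult[of k "1 :: 'a mps" "\<lambda>_. 0"]
    by (simp add: cf_one of_nat_eq_0_iff_char_dvd)
qed

lemma ps_mult_support:
  assumes "ps_mult P Q \<alpha> \<noteq> 0"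
  obtains \<beta> \<gamma> where "P \<beta> \<noteq> 0" "Q \<gamma> \<noteq> 0" "\<alpha> = (\<lambda>i. \<beta> i + \<gamma> i)"
proof -
  obtain \<beta> where "\<forall>i. \<beta> i \<le> \<alpha> i" "P \<beta> * Q (\<lambda>i. \<alpha> i - \<beta> i) \<noteq> 0"
    using sum.not_neutral_contains_not_neutral[OF assms[unfolded ps_mult_def]] by blast
  then show thesis by (intro that[of \<beta> "\<lambda>i. \<alpha> i - \<beta> i"]) auto
qed

text \<open>General enough to serve both for evaluating polynomials and for coding exponents by
  products of primes.\<close>

definition mon :: "(nat \<Rightarrow> 'a::comm_monoid_mult) \<Rightarrow> (nat \<Rightarrow> nat) \<Rightarrow> 'a" where
  "mon z \<alpha> = (\<Prod>i | \<alpha> i \<noteq> 0. z i ^ \<alpha> i)"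

lemma mon_superset:
  assumes "finite S" "{i. \<alpha> i \<noteq> 0} \<subseteq> S"
  shows "mon z \<alpha> = (\<Prod>i\<in>S. z i ^ \<alpha> i)"
  unfolding mon_def using assms by (intro prod.mono_neutral_left) auto

lemma mon_add:
  assumes "finsupp \<alpha>" "finsupp \<beta>"
  shows "mon z (\<lambda>i. \<alpha> i + \<beta> i) = mon z \<alpha> * mon z \<beta>"
proof -
  let ?S = "{i. \<alpha> i \<noteq> 0} \<union> {i. \<beta> i \<noteq> 0}"
  have S: "finite ?S" using assms by (simp add: finsupp_def)
  have "mon z (\<lambda>i. \<alpha> i + \<beta> i) = (\<Prod>i\<in>?S. z i ^ (\<alpha> i + \<beta> i))"
    and "mon z \<alpha> = (\<Prod>i\<in>?S. z i ^ \<alpha> i)" and "mon z \<beta> = (\<Prod>i\<in>?S. z i ^ \<beta> i)"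
    by (rule mon_superset[OF S]; auto)+
  then show ?thesis by (simp add: power_add prod.distrib)
qed

definition subring :: "'a::comm_ring_1 set \<Rightarrow> bool" where
  "subring R \<longleftrightarrow> 0 \<in> R \<and> 1 \<in> R \<and> (\<forall>x\<in>R. \<forall>y\<in>R. x + y \<in> R \<and> x * y \<in> R \<and> - x \<in> R)"

section \<open>Specialising finitely generated subalgebras\<close>

lemma
  assumes "field_hom \<phi>"
  shows field_hom_one: "\<phi> 1 = 1"
    and field_hom_add: "\<phi> (a + b) = \<phi> a + \<phi> b"
    and field_hom_mult: "\<phi> (a * b) = \<phi> a * \<phi> b"
    and field_hom_zero: "\<phi> 0 = 0"
    and field_hom_uminus: "\<phi> (- a) = - \<phi> a"
    and field_hom_eq_0_iff: "\<phi> a = 0 \<longleftrightarrow> a = 0"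
proof -
  show one: "\<phi> 1 = 1" and add: "\<And>a b. \<phi> (a + b) = \<phi> a + \<phi> b"
    and mult: "\<And>a b. \<phi> (a * b) = \<phi> a * \<phi> b"
    using assms by (auto simp: field_hom_def)
  show zero: "\<phi> 0 = 0" using add[of 0 0] by (metis add_0 add_cancel_left_right)
  show "\<phi> (- a) = - \<phi> a" using add[of a "- a"] zero by (simp add: eq_neg_iff_add_eq_0 add.commute)
  show "\<phi> a = 0 \<longleftrightarrow> a = 0"
  proof
    assume "\<phi> a = 0"
    then show "a = 0" using mult[of a "inverse a"] one by (cases "a = 0") auto
  qed (simp add: zero)
qed

lemmas field_hom_simps = field_hom_one field_hom_zero field_hom_eq_0_iff

lemma field_hom_sum: "field_hom \<phi> \<Longrightarrow> \<phi> (sum g A) = (\<Sum>x\<in>A. \<phi> (g x))"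
  by (induct A rule: infinite_finite_induct) (auto simp: field_hom_add field_hom_zero)

lemma field_hom_id: "field_hom (\<lambda>c. c)"
  by (simp add: field_hom_def)

text \<open>With syntax trees one and the same polynomial can be evaluated in K' through \<phi> and
  in K through the identity, and both values are handled by one structural induction.\<close>

datatype 'a pexp = Const 'a | Var nat | Plus "'a pexp" "'a pexp" | Times "'a pexp" "'a pexp"

primrec ev :: "('a \<Rightarrow> 'b::comm_ring_1) \<Rightarrow> (nat \<Rightarrow> 'b) \<Rightarrow> 'a pexp \<Rightarrow> 'b" where
  "ev \<phi> z (Const c) = \<phi> c"
| "ev \<phi> z (Var i) = z i"
| "ev \<phi> z (Plus D E) = ev \<phi> z D + ev \<phi> z E"
| "ev \<phi> z (Times D E) = ev \<phi> z D * ev \<phi> z E"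

primrec vars :: "'a pexp \<Rightarrow> nat set" where
  "vars (Const c) = {}"
| "vars (Var i) = {i}"
| "vars (Plus D E) = vars D \<union> vars E"
| "vars (Times D E) = vars D \<union> vars E"

lemma ev_cong: "(\<And>i. i \<in> vars E \<Longrightarrow> z i = z' i) \<Longrightarrow> ev \<phi> z E = ev \<phi> z' E"
  by (induct E) auto

primrec horner :: "(nat \<Rightarrow> 'a::zero pexp) \<Rightarrow> 'a pexp \<Rightarrow> nat \<Rightarrow> 'a pexp" where
  "horner E T 0 = Const 0"
| "horner E T (Suc d) = Plus (E 0) (Times T (horner (\<lambda>j. E (Suc j)) T d))"

lemma vars_horner: "vars (horner E T d) \<subseteq> vars T \<union> (\<Union>j<d. vars (E j))"
proof (induct d arbitrary: E)
  case (Suc d)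
  show ?case using Suc[of "\<lambda>j. E (Suc j)"] by fastforce
qed simp

lemma ev_horner:
  assumes "\<phi> 0 = 0"
  shows "ev \<phi> z (horner E T d) = (\<Sum>j<d. ev \<phi> z (E j) * ev \<phi> z T ^ j)"
  by (induct d arbitrary: E)
     (simp_all add: assms sum.lessThan_Suc_shift sum_distrib_left mult_ac del: sum.lessThan_Suc)

text \<open>There is a \<open>K\<close>-homomorphism mapping \<open>a i\<close> to \<open>b i\<close> for all \<open>i < s\<close> iff this set is the graph
  of a function, that is, iff it contains no \<open>(0, v)\<close> with \<open>v \<noteq> 0\<close>.\<close>

definition pvals :: "('a::field \<Rightarrow> 'b::field) \<Rightarrow> (nat \<Rightarrow> 'b) \<Rightarrow> (nat \<Rightarrow> 'a) \<Rightarrow> nat \<Rightarrow> ('b \<times> 'a) set" where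
  "pvals \<phi> a b s = {(ev \<phi> a E, ev (\<lambda>c. c) b E) | E. vars E \<subseteq> {..<s}}"

lemma pvalsI: "vars E \<subseteq> {..<s} \<Longrightarrow> (ev \<phi> a E, ev (\<lambda>c. c) b E) \<in> pvals \<phi> a b s"
  by (auto simp: pvals_def)

lemma pvalsE:
  assumes "(u, v) \<in> pvals \<phi> a b s"
  obtains E where "vars E \<subseteq> {..<s}" "u = ev \<phi> a E" "v = ev (\<lambda>c. c) b E"
  using assms by (auto simp: pvals_def)

lemma pvals_ring:
  assumes "field_hom \<phi>"
  shows pvals_const: "(\<phi> c, c) \<in> pvals \<phi> a b s"
    and pvals_zero: "(0, 0) \<in> pvals \<phi> a b s"
    and pvals_add: "(u, v) \<in> pvals \<phi> a b s \<Longrightarrow> (u', v') \<in> pvals \<phi> a b s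
                      \<Longrightarrow> (u + u', v + v') \<in> pvals \<phi> a b s"
    and pvals_mult: "(u, v) \<in> pvals \<phi> a b s \<Longrightarrow> (u', v') \<in> pvals \<phi> a b s
                      \<Longrightarrow> (u * u', v * v') \<in> pvals \<phi> a b s"
    and pvals_diff: "(u, v) \<in> pvals \<phi> a b s \<Longrightarrow> (u', v') \<in> pvals \<phi> a b s
                      \<Longrightarrow> (u - u', v - v') \<in> pvals \<phi> a b s"
proof -
  show const: "\<And>c. (\<phi> c, c) \<in> pvals \<phi> a b s"
    using pvalsI[of "Const _" s \<phi> a b] by simp
  from this[of 0] show "(0, 0) \<in> pvals \<phi> a b s" by (simp add: field_hom_zero[OF assms])
  show add: "(u + u', v + v') \<in> pvals \<phi> a b s"
    if uv: "(u, v) \<in> pvals \<phi> a b s" "(u', v') \<in> pvals \<phi> a b s" for u v u' v'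
  proof -
    obtain D E where "u = ev \<phi> a D" "v = ev (\<lambda>c. c) b D" "u' = ev \<phi> a E" "v' = ev (\<lambda>c. c) b E"
      "vars D \<subseteq> {..<s}" "vars E \<subseteq> {..<s}" using uv by (auto simp: pvals_def)
    then show ?thesis using pvalsI[of "Plus D E" s \<phi> a b] by simp
  qed
  show mult: "(u * u', v * v') \<in> pvals \<phi> a b s"
    if uv: "(u, v) \<in> pvals \<phi> a b s" "(u', v') \<in> pvals \<phi> a b s" for u v u' v'
  proof -
    obtain D E where "u = ev \<phi> a D" "v = ev (\<lambda>c. c) b D" "u' = ev \<phi> a E" "v' = ev (\<lambda>c. c) b E"
      "vars D \<subseteq> {..<s}" "vars E \<subseteq> {..<s}" using uv by (auto simp: pvals_def)
    then show ?thesis using pvalsI[of "Times D E" s \<phi> a b] by simp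
  qed
  show "(u - u', v - v') \<in> pvals \<phi> a b s"
    if uv: "(u, v) \<in> pvals \<phi> a b s" "(u', v') \<in> pvals \<phi> a b s"
    using add[OF uv(1) mult[OF const[of "-1"] uv(2)]]
    by (simp add: field_hom_uminus[OF assms] field_hom_one[OF assms])
qed

lemma pvals_sum:
  assumes "field_hom \<phi>" "\<And>x. x \<in> A \<Longrightarrow> (g x, h x) \<in> pvals \<phi> a b s"
  shows "(sum g A, sum h A) \<in> pvals \<phi> a b s"
  using assms(2)
  by (induct A rule: infinite_finite_induct) (auto simp: pvals_zero pvals_add assms(1))

text \<open>An expression is collected by powers of its last variable. \<open>A\<close> and
  \<open>B\<close> are built in parallel along the expression, so their coefficients are values of
  the same expressions in the first \<open>s\<close> variables, at \<open>a\<close> and at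
  \<open>b\<close>.\<close>

lemma pvals_Suc:
  assumes "field_hom \<phi>" "vars E \<subseteq> {..<Suc s}"
  shows "\<exists>A B. (\<forall>j. (coeff A j, coeff B j) \<in> pvals \<phi> a b s) \<and>
               poly A (a s) = ev \<phi> a E \<and> poly B (b s) = ev (\<lambda>c. c) b E"
  using assms(2)
proof (induct E)
  case (Const c)
  show ?case
    using pvals_const[OF assms(1), of c a b s] pvals_zero[OF assms(1), of a b s]
    by (intro exI[of _ "[:\<phi> c:]"] exI[of _ "[:c:]"]) (auto simp: coeff_pCons split: nat.split)
next
  case (Var i)
  show ?case
  proof (cases "i = s")
    case True
    show ?thesis
      using pvals_const[OF assms(1), of 1 a b s] pvals_zero[OF assms(1), of a b s] field_hom_simps[OF assms(1)] True
      by (intro exI[of _ "[:0, 1:]"]) (auto simp: coeff_pCons split: nat.split)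
  next
    case False
    then have "(a i, b i) \<in> pvals \<phi> a b s"
      using Var pvalsI[of "Var i" s \<phi> a b] by auto
    then show ?thesis
      using pvals_zero[OF assms(1), of a b s]
      by (intro exI[of _ "[:a i:]"] exI[of _ "[:b i:]"]) (auto simp: coeff_pCons split: nat.split)
  qed
next
  case (Plus D E)
  then have "vars D \<subseteq> {..<Suc s}" "vars E \<subseteq> {..<Suc s}" by simp_all
  with Plus.hyps obtain A B A' B' where
    "\<forall>j. (coeff A j, coeff B j) \<in> pvals \<phi> a b s" "poly A (a s) = ev \<phi> a D" "poly B (b s) = ev (\<lambda>c. c) b D"
    "\<forall>j. (coeff A' j, coeff B' j) \<in> pvals \<phi> a b s" "poly A' (a s) = ev \<phi> a E" "poly B' (b s) = ev (\<lambda>c. c) b E"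
    by meson
  then show ?case
    by (intro exI[of _ "A + A'"] exI[of _ "B + B'"]) (auto intro: pvals_add assms(1))
next
  case (Times D E)
  then have "vars D \<subseteq> {..<Suc s}" "vars E \<subseteq> {..<Suc s}" by simp_all
  with Times.hyps obtain A B A' B' where
    "\<forall>j. (coeff A j, coeff B j) \<in> pvals \<phi> a b s" "poly A (a s) = ev \<phi> a D" "poly B (b s) = ev (\<lambda>c. c) b D"
    "\<forall>j. (coeff A' j, coeff B' j) \<in> pvals \<phi> a b s" "poly A' (a s) = ev \<phi> a E" "poly B' (b s) = ev (\<lambda>c. c) b E"
    by meson
  then show ?case
    by (intro exI[of _ "A * A'"] exI[of _ "B * B'"])
       (auto simp: coeff_mult intro!: pvals_sum pvals_mult assms(1))
qed

text \<open>Pseudo-division of \<open>A\<close> by \<open>M\<close>, mirrored on \<open>B\<close>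
  and \<open>N\<close>; the coefficients form a ring without inverses, so \<open>A\<close> is first
  scaled by the leading coefficient of \<open>M\<close>. As \<open>N\<close> vanishes at
  \<open>b s\<close>, a step only multiplies the value of \<open>B\<close> by
  \<open>coeff N (degree M)\<close>, which cancels. Below the degree of \<open>M\<close>, minimality
  forces \<open>A = 0\<close>, and then \<open>graph\<close> forces \<open>B = 0\<close>.\<close>

lemma pvals_poly_vanish:
  assumes hom: "field_hom \<phi>"
    and graph: "\<And>v. (0, v) \<in> pvals \<phi> a b s \<Longrightarrow> v = 0"
    and minimal: "\<And>A. (\<And>j. coeff A j \<in> fst ` pvals \<phi> a b s) \<Longrightarrow> poly A (a s) = 0 \<Longrightarrow>
                    degree A < degree M \<Longrightarrow> A = 0"
    and M: "\<And>j. (coeff M j, coeff N j) \<in> pvals \<phi> a b s" "M \<noteq> 0" "poly M (a s) = 0"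
    and N: "coeff N (degree M) \<noteq> 0" "poly N (b s) = 0"
    and AB: "\<And>j. (coeff A j, coeff B j) \<in> pvals \<phi> a b s" "poly A (a s) = 0"
      "\<And>j. j \<ge> n \<Longrightarrow> coeff A j = 0"
  shows "poly B (b s) = 0"
  using AB
proof (induct n arbitrary: A B)
  case 0
  have "coeff B j = 0" for j using 0(1)[of j] 0(3)[of j] graph by simp
  then have "B = 0" by (simp add: poly_eq_iff)
  then show ?case by simp
next
  case (Suc n)
  define d where "d = degree M"
  show ?case
  proof (cases "n < d")
    case True
    have "degree A \<le> n" using Suc.prems(3) by (intro degree_le) auto
    then have "degree A < degree M" using True d_def by simp
    moreover have "coeff A j \<in> fst ` pvals \<phi> a b s" for j
      using Suc.prems(1)[of j] by force
    ultimately have "A = 0" using minimal Suc.prems(2) by blast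
    then show ?thesis using Suc.hyps[of A B] Suc.prems by simp
  next
    case False
    define A' where "A' = smult (coeff M d) A - smult (coeff A n) (monom 1 (n - d) * M)"
    define B' where "B' = smult (coeff N d) B - smult (coeff B n) (monom 1 (n - d) * N)"
    have "(coeff A' j, coeff B' j) \<in> pvals \<phi> a b s" for j
      unfolding A'_def B'_def coeff_diff coeff_smult coeff_monom_mult
      by (auto intro!: pvals_diff pvals_mult Suc.prems M(1) pvals_zero hom)
    moreover have "poly A' (a s) = 0"
      by (simp add: A'_def Suc.prems(2) M(3))
    moreover have "coeff A' j = 0" if "j \<ge> n" for j
    proof (cases "j = n")
      case True
      then show ?thesis using False by (simp add: A'_def coeff_monom_mult)
    next
      case neq: False
      then have "j - (n - d) > degree M" using that False d_def by simp
      then show ?thesis using neq that Suc.prems(3)[of j]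
        by (simp add: A'_def coeff_monom_mult coeff_eq_0)
    qed
    ultimately have "poly B' (b s) = 0" by (rule Suc.hyps)
    then show ?thesis using N by (simp add: B'_def d_def)
  qed
qed

text \<open>A generic form of Hilbert's basis theorem, by induction on \<open>s\<close>. The last
  generator is either transcendental over the others and imposes no condition, or it satisfies a
  polynomial of minimal degree, by which one can pseudo-divide once the leading coefficient
  stays nonzero.\<close>

lemma generic_finite_presentation:
  assumes hom: "field_hom (\<phi> :: 'a::field \<Rightarrow> 'b::field)"
  shows "\<exists>Fs D. finite Fs \<and> (\<forall>E\<in>Fs. vars E \<subseteq> {..<s} \<and> ev \<phi> a E = 0) \<and>
           vars D \<subseteq> {..<s} \<and> ev \<phi> a D \<noteq> 0 \<and>
           (\<forall>b. (\<forall>E\<in>Fs. ev (\<lambda>c. c) b E = 0) \<longrightarrow> ev (\<lambda>c. c) b D \<noteq> 0 \<longrightarrow>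
                (\<forall>v. (0, v) \<in> pvals \<phi> a b s \<longrightarrow> v = 0))"
proof (induct s)
  case 0
  have "v = 0" if v: "(0, v) \<in> pvals \<phi> a b 0" for b v
  proof -
    obtain E where E: "vars E = {}" "ev \<phi> a E = 0" "v = ev (\<lambda>c. c) b E"
      using pvalsE[OF v] by (metis lessThan_0 subset_empty)
    have "ev \<phi> a E = \<phi> (ev (\<lambda>c. c) b E)"
      using E(1) by (induct E) (auto simp: field_hom_add[OF hom] field_hom_mult[OF hom])
    then show ?thesis using E by (simp add: field_hom_eq_0_iff[OF hom])
  qed
  then show ?case
    by (intro exI[of _ "{}"] exI[of _ "Const 1"]) (auto simp: field_hom_one[OF hom])
next
  case (Suc s)
  obtain Fs D where Fs: "finite Fs" "\<And>E. E \<in> Fs \<Longrightarrow> vars E \<subseteq> {..<s}" "\<And>E. E \<in> Fs \<Longrightarrow> ev \<phi> a E = 0"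
    and D: "vars D \<subseteq> {..<s}" "ev \<phi> a D \<noteq> 0"
    and graph: "\<And>b v. (\<forall>E\<in>Fs. ev (\<lambda>c. c) b E = 0) \<Longrightarrow> ev (\<lambda>c. c) b D \<noteq> 0 \<Longrightarrow> (0, v) \<in> pvals \<phi> a b s \<Longrightarrow> v = 0"
    using Suc by (elim exE conjE) (metis (full_types))
  define R where "R = {ev \<phi> a E | E. vars E \<subseteq> {..<s}}"
  have R: "fst ` pvals \<phi> a b s = R" for b
    by (auto simp: R_def pvals_def image_iff)
  define Z where "Z A \<longleftrightarrow> (\<forall>j. coeff A j \<in> R) \<and> poly A (a s) = 0 \<and> A \<noteq> 0" for A
  show ?case
  proof (cases "\<exists>A. Z A")
    case False
    have "v = 0" if b: "\<forall>E\<in>Fs. ev (\<lambda>c. c) b E = 0" "ev (\<lambda>c. c) b D \<noteq> 0" and v: "(0, v) \<in> pvals \<phi> a b (Suc s)" for b v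
    proof -
      obtain E where E: "vars E \<subseteq> {..<Suc s}" "ev \<phi> a E = 0" "v = ev (\<lambda>c. c) b E"
        using pvalsE[OF v] by metis
      obtain A B where AB: "\<forall>j. (coeff A j, coeff B j) \<in> pvals \<phi> a b s" "poly A (a s) = 0" "poly B (b s) = v"
        using pvals_Suc[OF hom E(1), of a b] E by auto
      have "coeff A j \<in> R" for j using AB(1) R[of b] by force
      then have "A = 0" using False AB(2) by (auto simp: Z_def)
      then have "coeff B j = 0" for j using AB(1) graph[OF b] by simp
      then show ?thesis using AB(3) by (simp add: poly_altdef)
    qed
    moreover have "vars E \<subseteq> {..<Suc s}" if "E \<in> Fs" for E using Fs(2)[OF that] by auto
    moreover have "vars D \<subseteq> {..<Suc s}" using D by auto
    ultimately show ?thesis using Fs D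
      by (intro exI[of _ Fs] exI[of _ D] conjI ballI allI impI) blast+
  next
    case True
    define M where "M = arg_min degree Z"
    have M: "Z M" "\<And>A. Z A \<Longrightarrow> degree M \<le> degree A"
      using arg_min_nat_lemma[of Z _ degree] True by (auto simp: M_def)
    define d where "d = degree M"
    have "\<exists>E. vars E \<subseteq> {..<s} \<and> ev \<phi> a E = coeff M j" for j
      using M(1) by (auto simp: Z_def R_def) (metis (no_types, lifting))
    then obtain e where e: "\<And>j. vars (e j) \<subseteq> {..<s}" "\<And>j. ev \<phi> a (e j) = coeff M j"
      by metis
    \<comment> \<open>The bound is \<open>Suc d\<close> because \<open>horner\<close> stops before
      its bound: the coefficients used are \<open>e 0\<close> to \<open>e d\<close>. The new
      relation says that \<open>M\<close>, specialised to \<open>b\<close>, vanishes at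
      \<open>b s\<close>.\<close>
    define H where "H = horner e (Var s) (Suc d)"
    have H: "vars H \<subseteq> {..<Suc s}"
      using vars_horner[of e "Var s" "Suc d"] e(1) unfolding H_def by fastforce
    have "ev \<phi> a H = poly M (a s)"
      by (simp add: field_hom_zero[OF hom] H_def ev_horner e(2) poly_altdef d_def lessThan_Suc_atMost
          del: horner.simps sum.lessThan_Suc)
    then have H0: "ev \<phi> a H = 0" using M(1) by (simp add: Z_def)
    have lead: "ev \<phi> a (e d) \<noteq> 0" using M(1) by (simp add: e d_def Z_def)
    have "v = 0" if b: "\<forall>E\<in>Fs. ev (\<lambda>c. c) b E = 0" "ev (\<lambda>c. c) b D \<noteq> 0" "ev (\<lambda>c. c) b (e d) \<noteq> 0" "ev (\<lambda>c. c) b H = 0"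
      and v: "(0, v) \<in> pvals \<phi> a b (Suc s)" for b v
    proof -
      obtain E where E: "vars E \<subseteq> {..<Suc s}" "ev \<phi> a E = 0" "v = ev (\<lambda>c. c) b E"
        using pvalsE[OF v] by metis
      obtain A B where AB: "\<forall>j. (coeff A j, coeff B j) \<in> pvals \<phi> a b s" "poly A (a s) = 0" "poly B (b s) = v"
        using pvals_Suc[OF hom E(1), of a b] E by auto
      define N where "N = (\<Sum>j\<le>d. monom (ev (\<lambda>c. c) b (e j)) j)"
      have N: "coeff N j = (if j \<le> d then ev (\<lambda>c. c) b (e j) else 0)" for j
        by (simp add: N_def coeff_sum)
      have "ev (\<lambda>c. c) b H = poly N (b s)"
        by (simp add: H_def ev_horner N_def poly_sum poly_monom lessThan_Suc_atMost
          del: horner.simps sum.lessThan_Suc)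
      then have N0: "poly N (b s) = 0" using b by simp
      have MN: "(coeff M j, coeff N j) \<in> pvals \<phi> a b s" for j
        using pvalsI[OF e(1)[of j], of \<phi> a b] pvals_zero[OF hom, of a b s]
        by (auto simp: N e(2) d_def coeff_eq_0)
      have "poly B (b s) = 0"
      proof (rule pvals_poly_vanish[where n = "Suc (degree A)", OF hom graph[OF b(1,2)] _ MN])
        show "A = 0" if "\<And>j. coeff A j \<in> fst ` pvals \<phi> a b s" "poly A (a s) = 0" "degree A < degree M" for A
          using that M(2)[of A] by (force simp: R Z_def)
      qed (use M(1) N N0 b AB in \<open>auto simp: Z_def d_def intro: coeff_eq_0\<close>)
      then show ?thesis using AB by simp
    qed
    \<comment> \<open>The product packs two conditions into one: the old denominator and the leading
      coefficient of \<open>M\<close> both survive at \<open>b\<close>.\<close>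
    moreover have "vars (Times D (e d)) \<subseteq> {..<Suc s}" using D e(1)[of d] by auto
    moreover have "vars E \<subseteq> {..<Suc s}" if "E \<in> insert H Fs" for E
      using that Fs(2)[of E] H by (auto dest!: subsetD)
    moreover have "ev \<phi> a E = 0" if "E \<in> insert H Fs" for E
      using that Fs(3)[of E] H0 by auto
    moreover have "ev \<phi> a (Times D (e d)) \<noteq> 0" using D lead by simp
    moreover have "ev (\<lambda>c. c) b D \<noteq> 0 \<and> ev (\<lambda>c. c) b (e d) \<noteq> 0"
      if "ev (\<lambda>c. c) b (Times D (e d)) \<noteq> 0" for b using that by simp
    ultimately show ?thesis using Fs(1)
      by (intro exI[of _ "insert H Fs"] exI[of _ "Times D (e d)"] conjI ballI allI impI) blast+
  qed
qed

section \<open>Purity in terms of polynomial expressions\<close>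

lemma mpoly_eval_superset:
  assumes "finite S" "{\<alpha>. P \<alpha> \<noteq> 0} \<subseteq> S"
  shows "mpoly_eval P z = (\<Sum>\<alpha>\<in>S. P \<alpha> * mon z \<alpha>)"
  unfolding mpoly_eval_def mon_def[symmetric] using assms by (intro sum.mono_neutral_left) auto

lemma mpoly_alt: "mpoly P \<longleftrightarrow> finite {\<alpha>. P \<alpha> \<noteq> 0} \<and> (\<forall>\<alpha>. P \<alpha> \<noteq> 0 \<longrightarrow> finsupp \<alpha>)"
  by (simp add: mpoly_def finsupp_def)

lemma mpoly_eval_add:
  assumes "mpoly P" "mpoly Q"
  shows "mpoly_eval (ps_add P Q) z = mpoly_eval P z + mpoly_eval Q z"
proof -
  let ?S = "{\<alpha>. P \<alpha> \<noteq> 0} \<union> {\<alpha>. Q \<alpha> \<noteq> 0}"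
  have S: "finite ?S" using assms by (simp add: mpoly_def)
  have "mpoly_eval (ps_add P Q) z = (\<Sum>\<alpha>\<in>?S. ps_add P Q \<alpha> * mon z \<alpha>)"
    and "mpoly_eval P z = (\<Sum>\<alpha>\<in>?S. P \<alpha> * mon z \<alpha>)"
    and "mpoly_eval Q z = (\<Sum>\<alpha>\<in>?S. Q \<alpha> * mon z \<alpha>)"
    by (rule mpoly_eval_superset[OF S]; force simp: ps_add_def)+
  then show ?thesis by (simp add: ps_add_def sum.distrib distrib_right)
qed

lemma mpoly_add: "mpoly P \<Longrightarrow> mpoly Q \<Longrightarrow> mpoly (ps_add P (Q :: 'a::comm_ring_1 ps))"
proof -
  assume PQ: "mpoly P" "mpoly Q"
  have "{\<alpha>. ps_add P Q \<alpha> \<noteq> 0} \<subseteq> {\<alpha>. P \<alpha> \<noteq> 0} \<union> {\<alpha>. Q \<alpha> \<noteq> 0}"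
    by (auto simp: ps_add_def)
  then show ?thesis using PQ unfolding mpoly_alt
    by (auto intro: finite_subset)
qed

text \<open>The Cauchy product doubles as multiplication of polynomials: expand the product of the
  two evaluations over pairs of exponents and group the pairs by their sum \<open>h\<close>.\<close>

lemma mpoly_mult:
  fixes P Q :: "'a::comm_ring_1 ps"
  assumes "mpoly P" "mpoly Q"
  shows "mpoly (ps_mult P Q)"
    and "mpoly_eval (ps_mult P Q) z = mpoly_eval P z * mpoly_eval Q z"
proof -
  let ?A = "{\<alpha>. P \<alpha> \<noteq> 0}" and ?B = "{\<alpha>. Q \<alpha> \<noteq> 0}"
  define h :: "(nat \<Rightarrow> nat) \<times> (nat \<Rightarrow> nat) \<Rightarrow> nat \<Rightarrow> nat" where "h = (\<lambda>(\<beta>, \<gamma>) i. \<beta> i + \<gamma> i)"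
  have fin: "finite (?A \<times> ?B)" using assms by (auto simp: mpoly_alt)
  have fs: "finsupp \<beta>" "finsupp \<gamma>" if "(\<beta>, \<gamma>) \<in> ?A \<times> ?B" for \<beta> \<gamma>
    using assms that by (auto simp: mpoly_alt)
  have supp: "{\<alpha>. ps_mult P Q \<alpha> \<noteq> 0} \<subseteq> h ` (?A \<times> ?B)"
    by (force simp: h_def elim!: ps_mult_support)
  show "mpoly (ps_mult P Q)"
    using finite_subset[OF supp] fin ps_mult_infinite unfolding mpoly_alt by blast
  have coeff: "ps_mult P Q \<alpha> = (\<Sum>x | x \<in> ?A \<times> ?B \<and> h x = \<alpha>. P (fst x) * Q (snd x))"
    if \<alpha>: "\<alpha> \<in> h ` (?A \<times> ?B)" for \<alpha>
  proof -
    have "finsupp \<alpha>" using fs \<alpha> by (auto simp: h_def finsupp_add_iff)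
    then have "ps_mult P Q \<alpha> =
        (\<Sum>\<beta> | (\<forall>i. \<beta> i \<le> \<alpha> i) \<and> P \<beta> \<noteq> 0 \<and> Q (\<lambda>i. \<alpha> i - \<beta> i) \<noteq> 0. P \<beta> * Q (\<lambda>i. \<alpha> i - \<beta> i))"
      unfolding ps_mult_def by (intro sum.mono_neutral_right finite_atMost_fun) auto
    also have "\<dots> = (\<Sum>x | x \<in> ?A \<times> ?B \<and> h x = \<alpha>. P (fst x) * Q (snd x))"
      by (rule sum.reindex_bij_witness[of _ fst "\<lambda>\<beta>. (\<beta>, \<lambda>i. \<alpha> i - \<beta> i)"])
         (auto simp: h_def)
    finally show ?thesis .
  qed
  have "mpoly_eval (ps_mult P Q) z = (\<Sum>\<alpha>\<in>h ` (?A \<times> ?B). ps_mult P Q \<alpha> * mon z \<alpha>)"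
    using supp fin by (intro mpoly_eval_superset) auto
  also have "\<dots> = (\<Sum>\<alpha>\<in>h ` (?A \<times> ?B). \<Sum>x | x \<in> ?A \<times> ?B \<and> h x = \<alpha>. P (fst x) * Q (snd x) * mon z (h x))"
    by (rule sum.cong) (auto simp: coeff sum_distrib_right simp del: mem_Sigma_iff)
  also have "\<dots> = (\<Sum>x\<in>?A \<times> ?B. P (fst x) * Q (snd x) * mon z (h x))"
    by (rule sum.image_gen[OF fin, symmetric])
  also have "\<dots> = (\<Sum>x\<in>?A \<times> ?B. (P (fst x) * mon z (fst x)) * (Q (snd x) * mon z (snd x)))"
    using fs by (intro sum.cong) (auto simp: h_def mon_add mult_ac)
  also have "\<dots> = mpoly_eval P z * mpoly_eval Q z"
    unfolding mpoly_eval_def mon_def[symmetric] sum_product sum.cartesian_product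
    by (simp add: case_prod_unfold)
  finally show "mpoly_eval (ps_mult P Q) z = mpoly_eval P z * mpoly_eval Q z" .
qed

primrec mpoly_of :: "'a::field pexp \<Rightarrow> 'a ps" where
  "mpoly_of (Const c) = (\<lambda>\<alpha>. if \<alpha> = (\<lambda>_. 0) then c else 0)"
| "mpoly_of (Var i) = (\<lambda>\<alpha>. if \<alpha> = (\<lambda>j. if j = i then 1 else 0) then 1 else 0)"
| "mpoly_of (Plus D E) = ps_add (mpoly_of D) (mpoly_of E)"
| "mpoly_of (Times D E) = ps_mult (mpoly_of D) (mpoly_of E)"

text \<open>Keeping \<phi> general lets one induction cover K' as well as K, where \<phi> is the
  identity.\<close>

lemma mpoly_of:
  assumes hom: "field_hom (\<phi> :: 'a::field \<Rightarrow> 'b::field)"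
  shows "mpoly (\<phi> \<circ> mpoly_of E) \<and> mpoly_eval (\<phi> \<circ> mpoly_of E) z = ev \<phi> z E"
proof (induct E)
  case (Const c)
  have supp: "{\<alpha>. (\<phi> \<circ> mpoly_of (Const c)) \<alpha> \<noteq> 0} \<subseteq> {\<lambda>_. 0}"
    using field_hom_simps[OF hom] by auto
  then have "mpoly_eval (\<phi> \<circ> mpoly_of (Const c)) z = \<phi> c"
    by (subst mpoly_eval_superset[where S = "{\<lambda>_. 0}"]) (auto simp: mon_def)
  moreover have "mpoly (\<phi> \<circ> mpoly_of (Const c))"
    using finite_subset[OF supp] field_hom_simps[OF hom] by (auto simp: mpoly_alt)
  ultimately show ?case unfolding ev.simps by blast
next
  case (Var k)
  let ?e = "\<lambda>j. if j = k then 1 else 0 :: nat"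
  have supp: "{\<alpha>. (\<phi> \<circ> mpoly_of (Var k)) \<alpha> \<noteq> 0} \<subseteq> {?e}"
    using field_hom_simps[OF hom] by auto
  have "mon z ?e = z k"
    by (subst mon_superset[where S = "{k}"]) auto
  then have "mpoly_eval (\<phi> \<circ> mpoly_of (Var k)) z = z k"
    using supp field_hom_simps[OF hom] by (subst mpoly_eval_superset[where S = "{?e}"]) auto
  moreover have "finsupp ?e" by (simp add: finsupp_def)
  moreover from this have "mpoly (\<phi> \<circ> mpoly_of (Var k))"
    using finite_subset[OF supp] field_hom_simps[OF hom] by (auto simp: mpoly_alt)
  ultimately show ?case unfolding ev.simps by blast
next
  case (Plus D E)
  have "\<phi> \<circ> mpoly_of (Plus D E) = ps_add (\<phi> \<circ> mpoly_of D) (\<phi> \<circ> mpoly_of E)"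
    by (auto simp: ps_add_def field_hom_add[OF hom])
  then show ?case using Plus mpoly_add mpoly_eval_add unfolding ev.simps by metis
next
  case (Times D E)
  have "\<phi> \<circ> mpoly_of (Times D E) = ps_mult (\<phi> \<circ> mpoly_of D) (\<phi> \<circ> mpoly_of E)"
    by (auto simp: ps_mult_def field_hom_mult[OF hom] field_hom_sum[OF hom])
  then show ?case using Times mpoly_mult unfolding ev.simps by metis
qed

lemma mpoly_of_self:
  shows "mpoly (mpoly_of E)" and "mpoly_eval (mpoly_of E) z = ev (\<lambda>c. c) z E"
  using mpoly_of[OF field_hom_id, of E z] by (simp_all add: comp_def)

lemma alg_pureD:
  assumes hom: "field_hom \<phi>" and pure: "alg_pure \<phi>"
    and Fs: "finite Fs" "\<And>E. E \<in> Fs \<Longrightarrow> ev \<phi> a E = 0"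
  obtains b where "\<And>E. E \<in> Fs \<Longrightarrow> ev (\<lambda>c. c) b E = 0"
proof -
  obtain es where es: "set es = Fs" using finite_list[OF Fs(1)] by blast
  define F where "F k = mpoly_of (es ! k)" for k
  have "\<forall>k<length es. mpoly (F k)"
    by (simp add: F_def mpoly_of_self)
  moreover have "mpoly_eval (\<phi> \<circ> F k) a = 0" if "k < length es" for k
    using mpoly_of[OF hom, of "es ! k" a] Fs(2) es that by (auto simp: F_def)
  ultimately obtain b where b: "\<forall>k<length es. mpoly_eval (F k) b = 0"
    using pure[unfolded alg_pure_def, rule_format, of "length es" F] by blast
  have "ev (\<lambda>c. c) b E = 0" if E: "E \<in> Fs" for E
  proof -
    obtain k where "k < length es" "es ! k = E" using E es[symmetric] by (auto simp: in_set_conv_nth)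
    then show ?thesis using b mpoly_of_self(2)[of E b] unfolding F_def by metis
  qed
  then show thesis by (rule that)
qed

definition ring_hom_on :: "'b::comm_ring_1 set \<Rightarrow> ('b \<Rightarrow> 'a::comm_ring_1) \<Rightarrow> bool" where
  "ring_hom_on R \<psi> \<longleftrightarrow> \<psi> 0 = 0 \<and> \<psi> 1 = 1 \<and> (\<forall>x\<in>R. \<forall>y\<in>R. \<psi> (x + y) = \<psi> x + \<psi> y \<and> \<psi> (x * y) = \<psi> x * \<psi> y)"

text \<open>No quotient ring is formed: \<open>W\<close> pairs the values of each expression at
  \<open>a0\<close> and at \<open>b\<close>. Being closed under differences and containing no
  \<open>(0, v)\<close> with \<open>v \<noteq> 0\<close>, it is the graph of a homomorphism, defined
  on the algebra generated by \<open>A\<close>; constants show that it inverts \<phi>.\<close>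

theorem alg_pure_retraction:
  assumes hom: "field_hom (\<phi> :: 'a::field \<Rightarrow> 'b::field)" and pure: "alg_pure \<phi>" and A: "finite A"
  obtains R \<psi> where "A \<subseteq> R" "subring R" "ring_hom_on R \<psi>" "\<And>c. \<phi> c \<in> R" "\<And>c. \<psi> (\<phi> c) = c"
proof -
  obtain as where as: "set as = A" using finite_list[OF A] by blast
  define s where "s = length as"
  define a0 where "a0 i = (if i < s then as ! i else 0)" for i
  obtain Fs D where Fs: "finite Fs" "\<And>E. E \<in> Fs \<Longrightarrow> vars E \<subseteq> {..<s} \<and> ev \<phi> a0 E = 0"
    and D: "vars D \<subseteq> {..<s}" "ev \<phi> a0 D \<noteq> 0"
    and graph: "\<And>b v. (\<forall>E\<in>Fs. ev (\<lambda>c. c) b E = 0) \<Longrightarrow> ev (\<lambda>c. c) b D \<noteq> 0 \<Longrightarrow> (0, v) \<in> pvals \<phi> a0 b s \<Longrightarrow> v = 0"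
    using generic_finite_presentation[OF hom, of s a0] by (elim exE conjE) (metis (full_types))
  define a where "a = a0(s := inverse (ev \<phi> a0 D))"
  have a: "ev \<phi> a E = ev \<phi> a0 E" if "vars E \<subseteq> {..<s}" for E
    using that by (intro ev_cong) (auto simp: a_def)
  \<comment> \<open>Rabinowitsch's trick: purity knows equations only, so
    \<open>D \<noteq> 0\<close> is expressed by \<open>D * Var s - 1 = 0\<close> with the fresh
    variable \<open>s\<close>, whose value in K' is the inverse of \<open>D\<close>.\<close>
  define D1 where "D1 = Plus (Times D (Var s)) (Const (-1))"
  have "ev \<phi> a D1 = 0"
    using D by (simp add: D1_def a) (simp add: a_def field_hom_uminus[OF hom] field_hom_one[OF hom])
  then obtain b where b: "\<And>E. E \<in> insert D1 Fs \<Longrightarrow> ev (\<lambda>c. c) b E = 0"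
    using alg_pureD[OF hom pure, of "insert D1 Fs" a] Fs a by (metis finite_insert insert_iff)
  have "ev (\<lambda>c. c) b D \<noteq> 0" using b[of D1] by (auto simp: D1_def)
  then have gr: "v = 0" if "(0, v) \<in> pvals \<phi> a0 b s" for v
    using graph b that by blast
  define W where "W = pvals \<phi> a0 b s"
  have uniq: "v = v'" if "(u, v) \<in> W" "(u, v') \<in> W" for u v v'
    using pvals_diff[OF hom that[unfolded W_def]] gr[of "v - v'"] by simp
  define \<psi> where "\<psi> u = (THE v. (u, v) \<in> W)" for u
  have \<psi>: "\<psi> u = v" if "(u, v) \<in> W" for u v
    using that uniq unfolding \<psi>_def by blast
  note closed = pvals_ring[OF hom, where a = a0 and b = b and s = s, folded W_def]
  have const: "(1, 1) \<in> W" "(- 1, - 1) \<in> W" using closed(1)[of 1] closed(1)[of "-1"]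
    by (simp_all add: field_hom_uminus[OF hom] field_hom_one[OF hom])
  show thesis
  proof (rule that[of "fst ` W" \<psi>])
    show "A \<subseteq> fst ` W"
    proof
      fix x assume "x \<in> A"
      then obtain i where "i < s" "x = a0 i" using as by (auto simp: a0_def s_def in_set_conv_nth)
      then have "(x, b i) \<in> W" using pvalsI[of "Var i" s \<phi> a0 b] by (simp add: W_def)
      then show "x \<in> fst ` W" by force
    qed
    have mem: "u \<in> fst ` W" if "(u, v) \<in> W" for u v using that by force
    have "x + y \<in> fst ` W \<and> x * y \<in> fst ` W \<and> - x \<in> fst ` W"
      if xy: "x \<in> fst ` W" "y \<in> fst ` W" for x y
    proof -
      obtain v w where "(x, v) \<in> W" "(y, w) \<in> W" using xy by auto
      then show ?thesis
        using mem[OF closed(3)] mem[OF closed(4)] closed(4)[OF const(2)] mem[of "- x" "- v"] by auto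
    qed
    then show "subring (fst ` W)"
      using mem[OF closed(2)] mem[OF const(1)] unfolding subring_def by blast
    show "ring_hom_on (fst ` W) \<psi>"
      using closed(2) const(1) closed(3,4) unfolding ring_hom_on_def by (auto simp: \<psi>)
    show "\<phi> c \<in> fst ` W" "\<psi> (\<phi> c) = c" for c
      using closed(1)[of c] mem \<psi> by blast+
  qed
qed

section \<open>Coefficients of algebraic power series\<close>

text \<open>Identifying exponent vectors with positive integers by unique factorisation gives a
  monomial order of type \<open>\<omega>\<close>.\<close>

definition key :: "(nat \<Rightarrow> nat) \<Rightarrow> nat" where
  "key = mon (enumerate {p. prime p})"

lemma prime_enumerate: "prime (enumerate {p :: nat. prime p} i)"
  using enumerate_in_set[OF primes_infinite] by simp

lemma key_pos: "key \<alpha> > 0"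
  unfolding key_def mon_def by (intro prod_pos) (auto simp: prime_gt_0_nat prime_enumerate)

lemma key_add: "finsupp \<alpha> \<Longrightarrow> finsupp \<beta> \<Longrightarrow> key (\<lambda>i. \<alpha> i + \<beta> i) = key \<alpha> * key \<beta>"
  by (simp add: key_def mon_add)

lemma multiplicity_key:
  assumes "finsupp \<alpha>"
  shows "multiplicity (enumerate {p. prime p} i) (key \<alpha>) = \<alpha> i"
proof -
  let ?e = "enumerate {p :: nat. prime p}"
  have inj: "inj ?e" by (rule inj_enumerate[OF primes_infinite])
  have "key \<alpha> = (\<Prod>q\<in>?e ` {i. \<alpha> i \<noteq> 0}. q ^ \<alpha> (inv ?e q))"
    unfolding key_def mon_def
    by (subst prod.reindex) (use inj in \<open>auto intro: inj_on_subset\<close>)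
  also have "multiplicity (?e i) \<dots> = (if ?e i \<in> ?e ` {i. \<alpha> i \<noteq> 0} then \<alpha> (inv ?e (?e i)) else 0)"
    using assms by (intro multiplicity_prod_prime_powers) (auto simp: finsupp_def prime_enumerate)
  also have "\<dots> = \<alpha> i" using inj by (auto simp: inj_image_mem_iff)
  finally show ?thesis .
qed

lemma key_inject: "finsupp \<alpha> \<Longrightarrow> finsupp \<beta> \<Longrightarrow> key \<alpha> = key \<beta> \<Longrightarrow> \<alpha> = \<beta>"
  using multiplicity_key by (metis ext)

lemma finite_key_le: "finite {\<alpha>. finsupp \<alpha> \<and> key \<alpha> \<le> N}"
proof (rule finite_imageD)
  show "finite (key ` {\<alpha>. finsupp \<alpha> \<and> key \<alpha> \<le> N})"
    by (rule finite_subset[of _ "{..N}"]) auto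
  show "inj_on key {\<alpha>. finsupp \<alpha> \<and> key \<alpha> \<le> N}"
    by (auto intro!: inj_onI key_inject)
qed

text \<open>\<open>key\<close> acts as a multiplicative valuation: it turns sums of exponents into
  products, so lower bounds on supports multiply.\<close>

lemma cf_mult_key_ge:
  assumes "cf (g * h) \<alpha> \<noteq> 0"
    and "\<And>\<beta>. cf g \<beta> \<noteq> 0 \<Longrightarrow> M \<le> key \<beta>" "\<And>\<beta>. cf h \<beta> \<noteq> 0 \<Longrightarrow> N \<le> key \<beta>"
  shows "M * N \<le> key \<alpha>"
proof -
  obtain \<beta> \<gamma> where *: "cf g \<beta> \<noteq> 0" "cf h \<gamma> \<noteq> 0" "\<alpha> = (\<lambda>i. \<beta> i + \<gamma> i)"
    using assms(1) unfolding times_mps.rep_eq by (rule ps_mult_support)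
  then show ?thesis using assms(2)[of \<beta>] assms(3)[of \<gamma>]
    by (auto simp: key_add cf_nonzeroD intro: mult_le_mono)
qed

text \<open>Any other splitting of \<epsilon> + \<alpha> into exponents of \<open>g\<close> and
  \<open>h\<close> would have a strictly larger \<open>key\<close> on the left and no smaller one on
  the right, contradicting multiplicativity.\<close>

lemma cf_mult_lowest:
  assumes "finsupp \<epsilon>" "finsupp \<alpha>"
    and "\<And>\<beta>. cf g \<beta> \<noteq> 0 \<Longrightarrow> key \<epsilon> \<le> key \<beta>" "\<And>\<beta>. cf h \<beta> \<noteq> 0 \<Longrightarrow> key \<alpha> \<le> key \<beta>"
  shows "cf (g * h) (\<lambda>i. \<epsilon> i + \<alpha> i) = cf g \<epsilon> * cf h \<alpha>"
proof -
  have "cf g \<beta> * cf h (\<lambda>i. \<epsilon> i + \<alpha> i - \<beta> i) = (if \<beta> = \<epsilon> then cf g \<epsilon> * cf h \<alpha> else 0)"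
    if \<beta>: "\<forall>i. \<beta> i \<le> \<epsilon> i + \<alpha> i" for \<beta>
  proof (cases "cf g \<beta> = 0 \<or> cf h (\<lambda>i. \<epsilon> i + \<alpha> i - \<beta> i) = 0 \<or> \<beta> = \<epsilon>")
    case True
    then show ?thesis by auto
  next
    case False
    define \<gamma> where "\<gamma> = (\<lambda>i. \<epsilon> i + \<alpha> i - \<beta> i)"
    have fin: "finsupp \<beta>" "finsupp \<gamma>" using False by (auto simp: \<gamma>_def cf_nonzeroD)
    have "(\<lambda>i. \<beta> i + \<gamma> i) = (\<lambda>i. \<epsilon> i + \<alpha> i)" using \<beta> by (simp add: \<gamma>_def)
    then have "key \<beta> * key \<gamma> = key \<epsilon> * key \<alpha>" using key_add fin assms(1,2) by metis
    moreover have "key \<epsilon> \<le> key \<beta>" "key \<alpha> \<le> key \<gamma>" using assms(3,4) False by (auto simp: \<gamma>_def)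
    moreover have "key \<beta> \<noteq> key \<epsilon>" using False fin assms(1) key_inject by blast
    ultimately show ?thesis
      using key_pos[of \<alpha>] mult_less_le_imp_less[of "key \<epsilon>" "key \<beta>" "key \<alpha>" "key \<gamma>"] by simp
  qed
  then have "cf (g * h) (\<lambda>i. \<epsilon> i + \<alpha> i) =
      (\<Sum>\<beta> | \<forall>i. \<beta> i \<le> \<epsilon> i + \<alpha> i. if \<beta> = \<epsilon> then cf g \<epsilon> * cf h \<alpha> else 0)"
    unfolding cf_mult by (intro sum.cong) auto
  also have "\<dots> = cf g \<epsilon> * cf h \<alpha>"
    using assms(1,2) by (subst sum.delta) (auto intro!: finite_atMost_fun simp: finsupp_add_iff)
  finally show ?thesis .
qed

lemma subring_sum: "subring R \<Longrightarrow> (\<And>x. x \<in> A \<Longrightarrow> g x \<in> R) \<Longrightarrow> sum g A \<in> R"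
  by (induct A rule: infinite_finite_induct) (auto simp: subring_def)

lemma subring_cf_mult:
  "subring R \<Longrightarrow> (\<And>\<alpha>. cf g \<alpha> \<in> R) \<Longrightarrow> (\<And>\<alpha>. cf h \<alpha> \<in> R) \<Longrightarrow> cf (g * h) \<alpha> \<in> R"
  unfolding cf_mult by (intro subring_sum) (auto simp: subring_def)

lemma subring_cf_power: "subring R \<Longrightarrow> (\<And>\<alpha>. cf g \<alpha> \<in> R) \<Longrightarrow> cf (g ^ k) \<alpha> \<in> R"
proof (induct k arbitrary: \<alpha>)
  case 0 then show ?case by (auto simp: cf_one subring_def)
next
  case (Suc k) then show ?case by (simp add: subring_cf_mult)
qed

text \<open>Taylor expansion of Z^j to first order, with remainder divisible by the square of
  \<open>w\<close>. For \<open>j = 0\<close> the truncated exponent \<open>j - 1\<close> is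
  harmless, as its factor is 0.\<close>

lemma power_diff_expand:
  fixes g w :: "'a::comm_ring_1"
  shows "\<exists>q. (g - w) ^ j = g ^ j - of_nat j * g ^ (j - 1) * w + w * w * q"
proof (induct j)
  case (Suc j)
  then obtain q where "(g - w) ^ j = g ^ j - of_nat j * g ^ (j - 1) * w + w * w * q" by blast
  then have "(g - w) ^ Suc j = (g - w) * (g ^ j - of_nat j * g ^ (j - 1) * w + w * w * q)" by simp
  also have "\<dots> = g ^ Suc j - (g ^ j + of_nat j * (g * g ^ (j - 1))) * w
                   + w * w * (g * q - w * q + of_nat j * g ^ (j - 1))"
    by (simp add: algebra_simps)
  also have "g ^ j + of_nat j * (g * g ^ (j - 1)) = of_nat (Suc j) * g ^ (Suc j - 1)"
    by (cases j) (auto simp: algebra_simps)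
  finally show ?case by blast
qed (auto intro: exI[of _ 0])

lift_definition cut :: "nat \<Rightarrow> 'a::zero mps \<Rightarrow> 'a mps" is
  "\<lambda>N g \<alpha>. if key \<alpha> < N then g \<alpha> else 0"
  by (auto split: if_splits)

text \<open>Newton's method: if \<open>u\<close> collects the terms of \<open>g\<close> below \<open>\<alpha>\<close> and \<open>w = g - u\<close>, then
  \<open>P(u) = - P'(g) w + w\<^sup>2 q\<close>, where \<open>w\<^sup>2 q\<close> does not contribute to the monomial
  \<open>\<epsilon> + \<alpha>\<close>, \<open>\<epsilon>\<close> being the lowest exponent of \<open>P'(g)\<close>.\<close>

lemma coefficients_simple_root:
  fixes g :: "'b::field mps"
  assumes root: "(\<Sum>j\<le>d. c j * g ^ j) = 0"
    and simple: "(\<Sum>j\<le>d. of_nat j * c j * g ^ (j - 1)) \<noteq> 0"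
  shows "\<exists>A. finite A \<and> (\<forall>R. subring R \<longrightarrow> A \<subseteq> R \<longrightarrow> (\<forall>j\<le>d. \<forall>\<alpha>. cf (c j) \<alpha> \<in> R) \<longrightarrow> (\<forall>\<alpha>. cf g \<alpha> \<in> R))"
proof -
  define D where "D = (\<Sum>j\<le>d. of_nat j * c j * g ^ (j - 1))"
  have "\<exists>\<alpha>. cf D \<alpha> \<noteq> 0" using simple mps_eqI[of D 0] unfolding D_def by auto
  then obtain \<epsilon> where \<epsilon>: "cf D \<epsilon> \<noteq> 0" "\<And>\<beta>. cf D \<beta> \<noteq> 0 \<Longrightarrow> key \<epsilon> \<le> key \<beta>"
    using arg_min_nat_lemma[of "\<lambda>\<alpha>. cf D \<alpha> \<noteq> 0" _ key] by metis
  then have fin\<epsilon>: "finsupp \<epsilon>" by (simp add: cf_nonzeroD)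
  \<comment> \<open>The cut-off is \<open>key \<epsilon>\<close> because \<open>w * w * Q\<close>
    starts at \<open>key \<alpha> * key \<alpha>\<close>, which exceeds
    \<open>key \<epsilon> * key \<alpha>\<close>, the key of \<epsilon> + \<alpha>, just when
    \<open>key \<epsilon> < key \<alpha>\<close>. The inverse is needed to solve for the coefficient
    at \<alpha>.\<close>
  define A where "A = insert (inverse (cf D \<epsilon>)) (cf g ` {\<beta>. finsupp \<beta> \<and> key \<beta> \<le> key \<epsilon>})"
  have "cf g \<alpha> \<in> R" if R: "subring R" "A \<subseteq> R" and c: "\<forall>j\<le>d. \<forall>\<alpha>. cf (c j) \<alpha> \<in> R" for R \<alpha>
  proof (induct "key \<alpha>" arbitrary: \<alpha> rule: less_induct)
    case less
    show ?case
    proof (cases "finsupp \<alpha> \<and> key \<epsilon> < key \<alpha>")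
      case False
      then show ?thesis using R by (cases "finsupp \<alpha>") (auto simp: A_def cf_eq_0 subring_def)
    next
      case True
      define u where "u = cut (key \<alpha>) g"
      define w where "w = g - u"
      have u: "cf u \<beta> = (if key \<beta> < key \<alpha> then cf g \<beta> else 0)" for \<beta>
        unfolding u_def by transfer simp
      have uR: "cf u \<beta> \<in> R" for \<beta> using less[of \<beta>] R(1) by (auto simp: u subring_def)
      have w: "key \<alpha> \<le> key \<beta>" if "cf w \<beta> \<noteq> 0" for \<beta>
        using that by (auto simp: w_def u split: if_splits)
      obtain q where q: "\<And>j. (g - w) ^ j = g ^ j - of_nat j * g ^ (j - 1) * w + w * w * q j"
        using power_diff_expand[of g w] by metis
      define Q where "Q = (\<Sum>j\<le>d. c j * q j)"
      have "(\<Sum>j\<le>d. c j * u ^ j) = (\<Sum>j\<le>d. c j * (g - w) ^ j)" by (simp add: w_def)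
      also have "\<dots> = (\<Sum>j\<le>d. c j * g ^ j - of_nat j * c j * g ^ (j - 1) * w + w * w * (c j * q j))"
        by (intro sum.cong) (auto simp: q algebra_simps)
      also have "\<dots> = w * w * Q - D * w"
        by (simp add: sum.distrib sum_subtractf root Q_def D_def flip: sum_distrib_left sum_distrib_right)
      finally have Pu: "(\<Sum>j\<le>d. c j * u ^ j) = w * w * Q - D * w" .
      have "cf (w * w * Q) (\<lambda>i. \<epsilon> i + \<alpha> i) = 0"
      proof (rule ccontr)
        assume "cf (w * w * Q) (\<lambda>i. \<epsilon> i + \<alpha> i) \<noteq> 0"
        then have "(key \<alpha> * key \<alpha>) * 1 \<le> key (\<lambda>i. \<epsilon> i + \<alpha> i)"
          by (rule cf_mult_key_ge) (use key_pos w in \<open>auto simp: Suc_le_eq intro: cf_mult_key_ge[of w w]\<close>)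
        then show False using True fin\<epsilon> key_pos[of \<alpha>] by (simp add: key_add)
      qed
      moreover have "cf (D * w) (\<lambda>i. \<epsilon> i + \<alpha> i) = cf D \<epsilon> * cf g \<alpha>"
        using cf_mult_lowest[of \<epsilon> \<alpha> D w] \<epsilon> w fin\<epsilon> True by (simp add: w_def u)
      ultimately have "cf (\<Sum>j\<le>d. c j * u ^ j) (\<lambda>i. \<epsilon> i + \<alpha> i) = - (cf D \<epsilon> * cf g \<alpha>)"
        by (simp add: Pu)
      then have "cf g \<alpha> = inverse (cf D \<epsilon>) * - cf (\<Sum>j\<le>d. c j * u ^ j) (\<lambda>i. \<epsilon> i + \<alpha> i)"
        using \<epsilon>(1) by (simp add: field_simps)
      moreover have "cf (\<Sum>j\<le>d. c j * u ^ j) (\<lambda>i. \<epsilon> i + \<alpha> i) \<in> R"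
        unfolding cf_sum using R(1) c uR by (intro subring_sum subring_cf_mult subring_cf_power) auto
      ultimately show ?thesis using R by (auto simp: subring_def A_def)
    qed
  qed
  moreover have "finite A" by (simp add: A_def finite_key_le)
  ultimately show ?thesis by blast
qed

section \<open>Frobenius on power series and inseparable annihilators\<close>

lift_definition monomial :: "(nat \<Rightarrow> nat) \<Rightarrow> 'a::zero \<Rightarrow> 'a mps" is
  "\<lambda>\<beta> c \<alpha>. if \<alpha> = \<beta> \<and> finsupp \<beta> then c else 0"
  by (auto split: if_splits)

lemma cf_monomial: "cf (monomial \<beta> c) \<alpha> = (if \<alpha> = \<beta> \<and> finsupp \<beta> then c else 0)"
  by transfer simp

lemma monomial_mult:
  assumes "finsupp \<beta>" "finsupp \<gamma>"
  shows "monomial \<beta> c * monomial \<gamma> e = monomial (\<lambda>i. \<beta> i + \<gamma> i) (c * e)"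
proof (rule mps_eqI)
  fix \<alpha> assume "finsupp \<alpha>"
  have "cf (monomial \<beta> c * monomial \<gamma> e) \<alpha> =
      (\<Sum>\<delta> | \<forall>i. \<delta> i \<le> \<alpha> i. if \<delta> = \<beta> then (if \<alpha> = (\<lambda>i. \<beta> i + \<gamma> i) then c * e else 0) else 0)"
    unfolding cf_mult proof (intro sum.cong refl)
    fix \<delta> assume "\<delta> \<in> {\<delta>. \<forall>i. \<delta> i \<le> \<alpha> i}"
    then have "(\<lambda>i. \<alpha> i - \<delta> i) = \<gamma> \<longleftrightarrow> \<alpha> = (\<lambda>i. \<delta> i + \<gamma> i)" by auto
    then show "cf (monomial \<beta> c) \<delta> * cf (monomial \<gamma> e) (\<lambda>i. \<alpha> i - \<delta> i) =
        (if \<delta> = \<beta> then (if \<alpha> = (\<lambda>i. \<beta> i + \<gamma> i) then c * e else 0) else 0)"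
      using assms by (auto simp: cf_monomial)
  qed
  then show "cf (monomial \<beta> c * monomial \<gamma> e) \<alpha> = cf (monomial (\<lambda>i. \<beta> i + \<gamma> i) (c * e)) \<alpha>"
    using finite_atMost_fun[OF \<open>finsupp \<alpha>\<close>] assms
    by (auto simp: sum.delta cf_monomial finsupp_add_iff)
qed

lemma finsupp_mult: "finsupp \<beta> \<Longrightarrow> finsupp (\<lambda>i. k * \<beta> i)"
  unfolding finsupp_def by (rule finite_subset[rotated]) auto

lemma monomial_power:
  assumes "finsupp \<beta>"
  shows "monomial \<beta> c ^ k = monomial (\<lambda>i. k * \<beta> i) (c ^ k)"
proof (induct k)
  case 0
  show ?case by (rule mps_eqI) (auto simp: cf_monomial cf_one)
next
  case (Suc k)
  then show ?case using assms by (simp add: monomial_mult finsupp_mult)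
qed

text \<open>The freshman's dream applies to finite sums, so \<open>h\<close> is split into its
  finitely many terms below \<alpha> and a rest \<open>t\<close>. A multiple of \<open>t\<close> has
  no coefficient at \<alpha>, since \<open>t\<close> vanishes at every exponent below
  \<alpha>.\<close>

lemma cf_power_CHAR:
  fixes h :: "'b::comm_ring_1 mps"
  assumes p: "prime p" "p = CHAR('b)" and \<alpha>: "finsupp \<alpha>"
  shows "cf (h ^ p) \<alpha> = (if \<forall>i. p dvd \<alpha> i then cf h (\<lambda>i. \<alpha> i div p) ^ p else 0)"
proof -
  have p': "prime CHAR('b mps)" "p = CHAR('b mps)" using p by (simp_all add: CHAR_mps)
  have p0: "p > 0" using p(1) by (rule prime_gt_0_nat)
  let ?B = "{\<beta>. \<forall>i. \<beta> i \<le> \<alpha> i}"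
  have fin: "finite ?B" using \<alpha> by (rule finite_atMost_fun)
  have fs: "finsupp \<beta>" if "\<beta> \<in> ?B" for \<beta>
    using that by (auto intro!: finsupp_mono[OF \<alpha>] simp: le_fun_def)
  define m where "m = (\<Sum>\<beta>\<in>?B. monomial \<beta> (cf h \<beta>))"
  define t where "t = h - m"
  have "cf t \<beta> = 0" if "\<beta> \<in> ?B" for \<beta>
  proof -
    have "cf m \<beta> = (\<Sum>\<gamma>\<in>?B. if \<gamma> = \<beta> then cf h \<beta> else 0)"
      unfolding m_def cf_sum by (intro sum.cong) (use fs in \<open>auto simp: cf_monomial\<close>)
    also have "\<dots> = cf h \<beta>" using fin that by (simp add: sum.delta)
    finally show ?thesis by (simp add: t_def)
  qed
  then have t: "cf (t * s) \<alpha> = 0" for s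
    unfolding cf_mult by (intro sum.neutral) auto
  have "h ^ p = (m + t) ^ p" by (simp add: t_def)
  also have "\<dots> = (\<Sum>\<beta>\<in>?B. monomial \<beta> (cf h \<beta>) ^ p) + t ^ p"
    unfolding m_def using p' by (simp add: freshmans_dream freshmans_dream_sum)
  finally have "cf (h ^ p) \<alpha> = (\<Sum>\<beta>\<in>?B. cf (monomial \<beta> (cf h \<beta>) ^ p) \<alpha>)"
    using t[of "t ^ (p - 1)"] p0 by (simp add: cf_sum power_eq_if[of t p])
  also have "\<dots> = (\<Sum>\<beta>\<in>?B. if \<alpha> = (\<lambda>i. p * \<beta> i) then cf h \<beta> ^ p else 0)"
    by (intro sum.cong) (use fs in \<open>auto simp: monomial_power cf_monomial finsupp_mult\<close>)
  also have "\<dots> = (if \<forall>i. p dvd \<alpha> i then cf h (\<lambda>i. \<alpha> i div p) ^ p else 0)"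
  proof (cases "\<forall>i. p dvd \<alpha> i")
    case True
    then have "\<alpha> = (\<lambda>i. p * \<beta> i) \<longleftrightarrow> \<beta> = (\<lambda>i. \<alpha> i div p)" for \<beta> using p0 by (auto simp: fun_eq_iff)
    then show ?thesis using fin True by (simp add: sum.delta)
  next
    case False
    then show ?thesis by (intro trans[OF sum.neutral]) auto
  qed
  finally show ?thesis .
qed

text \<open>A p-th power lives on exponents divisible by \<open>p\<close>, so only exponents of
  \<open>c\<close> congruent to \<rho> contribute; after division by \<open>p\<close> an ordinary
  convolution at \<tau> remains.\<close>

lemma cf_mult_power_CHAR:
  fixes c h :: "'b::comm_ring_1 mps"
  assumes p: "prime p" "p = CHAR('b)" and fin: "finsupp \<rho>" "finsupp \<tau>" and \<rho>: "\<And>i. \<rho> i < p"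
  shows "cf (c * h ^ p) (\<lambda>i. \<rho> i + p * \<tau> i) =
    (\<Sum>\<sigma> | \<forall>i. \<sigma> i \<le> \<tau> i. cf c (\<lambda>i. \<rho> i + p * \<sigma> i) * cf h (\<lambda>i. \<tau> i - \<sigma> i) ^ p)"
proof -
  have p0: "p > 0" using p(1) by (rule prime_gt_0_nat)
  let ?\<alpha> = "\<lambda>i. \<rho> i + p * \<tau> i"
  have \<alpha>: "finsupp ?\<alpha>" using fin by (simp add: finsupp_add_iff finsupp_mult)
  \<comment> \<open>The bound \<open>\<rho> i < p\<close> makes the quotient at most
    \<open>\<tau> i\<close>, so the truncated subtraction from \<open>\<tau> i\<close> is a true one
    and the reindexing can be inverted.\<close>
  have reconstruct: "\<rho> i + p * (\<tau> i - (?\<alpha> i - l) div p) = l \<and> (?\<alpha> i - l) div p \<le> \<tau> i"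
    if le: "l \<le> ?\<alpha> i" and dvd: "p dvd ?\<alpha> i - l" for i l
  proof -
    obtain k where k: "?\<alpha> i - l = p * k" using dvd by (auto elim: dvdE)
    then have "p * k < p * Suc (\<tau> i)" using \<rho>[of i] by simp
    then have "k \<le> \<tau> i" by (metis mult_less_cancel1 less_Suc_eq_le)
    moreover from this have "\<rho> i + p * (\<tau> i - k) = l" using k le by (simp add: diff_mult_distrib2)
    ultimately show ?thesis using k p0 by simp
  qed
  have "cf (c * h ^ p) ?\<alpha> = (\<Sum>\<beta> | \<forall>i. \<beta> i \<le> ?\<alpha> i. cf c \<beta> *
          (if \<forall>i. p dvd ?\<alpha> i - \<beta> i then cf h (\<lambda>i. (?\<alpha> i - \<beta> i) div p) ^ p else 0))"
    unfolding cf_mult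
    by (intro sum.cong refl arg_cong2[of _ _ _ _ "(*)"] cf_power_CHAR[OF p] finsupp_mono[OF \<alpha>])
       (auto simp: le_fun_def)
  also have "\<dots> = (\<Sum>\<beta> | (\<forall>i. \<beta> i \<le> ?\<alpha> i) \<and> (\<forall>i. p dvd ?\<alpha> i - \<beta> i).
                     cf c \<beta> * cf h (\<lambda>i. (?\<alpha> i - \<beta> i) div p) ^ p)"
    by (rule sum.mono_neutral_cong_right[OF finite_atMost_fun[OF \<alpha>]]) auto
  also have "\<dots> = (\<Sum>\<sigma> | \<forall>i. \<sigma> i \<le> \<tau> i. cf c (\<lambda>i. \<rho> i + p * \<sigma> i) * cf h (\<lambda>i. \<tau> i - \<sigma> i) ^ p)"
  proof (rule sum.reindex_bij_witness[of _ "\<lambda>\<sigma> i. \<rho> i + p * \<sigma> i" "\<lambda>\<beta> i. \<tau> i - (?\<alpha> i - \<beta> i) div p"], goal_cases)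
    case (1 \<beta>)
    then show ?case using reconstruct by auto
  next
    case (3 \<sigma>)
    have "(\<rho> i + p * \<tau> i - (\<rho> i + p * \<sigma> i)) div p = \<tau> i - \<sigma> i" for i
      using p0 by (simp flip: diff_mult_distrib2)
    then show ?case using 3 by (simp add: fun_eq_iff)
  next
    case (4 \<sigma>)
    then show ?case by (auto simp flip: diff_mult_distrib2)
  next
    case (5 \<beta>)
    then have "\<rho> i + p * (\<tau> i - (?\<alpha> i - \<beta> i) div p) = \<beta> i \<and> (?\<alpha> i - \<beta> i) div p \<le> \<tau> i" for i
      using reconstruct by auto
    then show ?case by simp
  qed auto
  finally show ?thesis .
qed

text \<open>Over a perfect field this would be \<open>b \<mapsto> b\<^bsup>1/p\<^esup>\<close>; in general one chooses a
  linear functional over the subfield of \<open>p\<close>-th powers.\<close>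

lemma root_functional:
  fixes x :: "'b::field"
  assumes p: "prime p" "p = CHAR('b)" and "x \<noteq> 0"
  obtains \<Lambda> :: "'b \<Rightarrow> 'b" where "\<And>a b. \<Lambda> (a + b) = \<Lambda> a + \<Lambda> b" "\<And>a b. \<Lambda> (a ^ p * b) = a * \<Lambda> b" "\<Lambda> x = 1"
proof -
  \<comment> \<open>K' is a vector space over itself with \<open>a\<close> acting as multiplication
    by \<open>a ^ p\<close>; distributivity in the scalar is the freshman's dream. A linear map from
    it to K' with its usual structure extracts p-th roots of scalars.\<close>
  interpret vector_space_pair "\<lambda>a b :: 'b. a ^ p * b" "(*) :: 'b \<Rightarrow> 'b \<Rightarrow> 'b"
    by unfold_locales
       (use p in \<open>auto simp: algebra_simps power_mult_distrib freshmans_dream\<close>)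
  have "vs1.independent {x}"
    using \<open>x \<noteq> 0\<close> by (intro vs1.independent_insertI) (auto simp: vs1.independent_empty)
  then obtain \<Lambda> where lin: "Vector_Spaces.linear (\<lambda>a b :: 'b. a ^ p * b) (*) \<Lambda>" and "\<forall>y\<in>{x}. \<Lambda> y = 1"
    using linear_independent_extend[of "{x}" "\<lambda>_. 1"] by blast
  then show thesis
    using that[of \<Lambda>] linear_add[OF lin] linear_scale[OF lin] by blast
qed

text \<open>\<open>d\<close> only bounds the degree, as \<open>c d\<close> may be 0. The
  coefficients need finite support but no prescribed variables: what matters is that they have
  finitely many nonzero values.\<close>

definition annihilates :: "nat \<Rightarrow> (nat \<Rightarrow> 'b::comm_ring_1 mps) \<Rightarrow> 'b mps \<Rightarrow> bool" where
  "annihilates d c g \<longleftrightarrow> (\<forall>j\<le>d. finite {\<alpha>. cf (c j) \<alpha> \<noteq> 0}) \<and> (\<exists>j\<le>d. c j \<noteq> 0) \<and>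
     (\<Sum>j\<le>d. c j * g ^ j) = 0"

text \<open>In an annihilating polynomial of the form \<open>\<Sum>\<^sub>i c\<^sub>i Z\<^bsup>pi\<^esup>\<close>, applying a \<open>p\<close>-th root
  functional to the coefficients in one residue class of exponents modulo \<open>p\<close> divides the
  degree by \<open>p\<close>.\<close>

lemma annihilates_CHAR:
  fixes g :: "'b::field mps"
  assumes p: "prime p" "p = CHAR('b)"
    and fin: "\<And>j. j \<le> m \<Longrightarrow> finite {\<alpha>. cf (c j) \<alpha> \<noteq> 0}" and "c m \<noteq> 0"
    and root: "(\<Sum>j\<le>m. c j * (g ^ j) ^ p) = 0"
  shows "\<exists>e. annihilates m e g"
proof -
  have p0: "p > 0" using p(1) by (rule prime_gt_0_nat)
  obtain \<alpha> where \<alpha>: "cf (c m) \<alpha> \<noteq> 0" using \<open>c m \<noteq> 0\<close> mps_eqI[of "c m" 0] by auto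
  obtain \<Lambda> where \<Lambda>: "\<And>a b. \<Lambda> (a + b) = \<Lambda> a + \<Lambda> b" "\<And>a b. \<Lambda> (a ^ p * b) = a * \<Lambda> b"
    and \<Lambda>1: "\<Lambda> (cf (c m) \<alpha>) = 1"
    using root_functional[OF p \<alpha>] by metis
  then have \<Lambda>': "\<Lambda> (b * a ^ p) = \<Lambda> b * a" for a b by (metis mult.commute)
  have \<Lambda>0: "\<Lambda> 0 = 0" using \<Lambda>(1)[of 0 0] by (metis add_0 add_cancel_left_right)
  have \<Lambda>_sum: "\<Lambda> (sum h S) = (\<Sum>x\<in>S. \<Lambda> (h x))" for h :: "'x \<Rightarrow> 'b" and S
    by (induct S rule: infinite_finite_induct) (auto simp: \<Lambda>(1) \<Lambda>0)
  \<comment> \<open>The residue class is that of an exponent \<alpha> at which \<open>c m\<close>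
    has a nonzero coefficient. Since \<Lambda> is 1 on this coefficient, \<open>e m\<close> stays
    nonzero.\<close>
  define \<rho> where "\<rho> i = \<alpha> i mod p" for i
  have fin\<alpha>: "finsupp \<alpha>" using \<alpha> by (rule cf_nonzeroD)
  then have fin\<rho>: "finsupp \<rho>" by (rule finsupp_mono) (auto simp: \<rho>_def le_fun_def)
  define s where "s \<sigma> = (\<lambda>i. \<rho> i + p * \<sigma> i)" for \<sigma>
  have inj: "inj s"
    using p0 by (intro injI) (auto simp: s_def fun_eq_iff)
  define e where "e j = Mps (\<lambda>\<sigma>. \<Lambda> (cf (c j) (s \<sigma>)))" for j
  have e: "cf (e j) \<sigma> = \<Lambda> (cf (c j) (s \<sigma>))" for j \<sigma>
  proof -
    have "finsupp \<tau>" if "\<Lambda> (cf (c j) (s \<tau>)) \<noteq> 0" for \<tau>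
    proof -
      have "finsupp (s \<tau>)" using that \<Lambda>0 cf_eq_0 by metis
      then have "finsupp (\<lambda>i. p * \<tau> i)" by (simp add: s_def finsupp_add_iff)
      then show ?thesis using p0 by (simp add: finsupp_def)
    qed
    then show ?thesis unfolding e_def by (subst Mps_inverse) auto
  qed
  have "finite {\<sigma>. cf (e j) \<sigma> \<noteq> 0}" if "j \<le> m" for j
  proof (rule finite_subset)
    show "{\<sigma>. cf (e j) \<sigma> \<noteq> 0} \<subseteq> s -` {\<alpha>. cf (c j) \<alpha> \<noteq> 0}" using e \<Lambda>0 by auto
    show "finite (s -` {\<alpha>. cf (c j) \<alpha> \<noteq> 0})" using fin[OF that] inj by (rule finite_vimageI)
  qed
  moreover have "s (\<lambda>i. \<alpha> i div p) = \<alpha>" by (auto simp: s_def \<rho>_def)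
  then have "e m \<noteq> 0" using e[of m "\<lambda>i. \<alpha> i div p"] \<Lambda>1 by auto
  moreover have "(\<Sum>j\<le>m. e j * g ^ j) = 0"
  proof (rule mps_eqI)
    fix \<tau> assume \<tau>: "finsupp \<tau>"
    \<comment> \<open>\<Lambda> replaces each p-th power factor by its root, so this coefficient is
      \<Lambda> of the coefficient of the given relation at \<open>s \<tau>\<close>.\<close>
    have "cf (\<Sum>j\<le>m. e j * g ^ j) \<tau> =
      (\<Sum>j\<le>m. \<Sum>\<sigma> | \<forall>i. \<sigma> i \<le> \<tau> i. \<Lambda> (cf (c j) (s \<sigma>) * cf (g ^ j) (\<lambda>i. \<tau> i - \<sigma> i) ^ p))"
      by (simp add: cf_sum cf_mult e \<Lambda>')
    also have "\<dots> = \<Lambda> (cf (\<Sum>j\<le>m. c j * (g ^ j) ^ p) (s \<tau>))"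
    proof -
      have "cf (c j * (g ^ j) ^ p) (s \<tau>) =
          (\<Sum>\<sigma> | \<forall>i. \<sigma> i \<le> \<tau> i. cf (c j) (s \<sigma>) * cf (g ^ j) (\<lambda>i. \<tau> i - \<sigma> i) ^ p)" for j
        unfolding s_def by (rule cf_mult_power_CHAR[OF p fin\<rho> \<tau>]) (simp add: \<rho>_def p0)
      then show ?thesis by (simp add: cf_sum \<Lambda>_sum)
    qed
    also have "\<dots> = 0" by (simp add: root \<Lambda>0)
    finally show "cf (\<Sum>j\<le>m. e j * g ^ j) \<tau> = cf 0 \<tau>" by simp
  qed
  ultimately show ?thesis unfolding annihilates_def by blast
qed

text \<open>For minimal \<open>d\<close>, the relation P'(g) = 0 would have smaller degree, so all
  \<open>j * c j\<close> vanish and P is a polynomial in Z^p. Then \<open>annihilates_CHAR\<close>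
  reaches the smaller degree \<open>m\<close> with \<open>d = p * m\<close>.\<close>

lemma separable_annihilator:
  fixes g :: "'b::field mps"
  assumes "annihilates d0 c0 g"
  obtains d c where "annihilates d c g" "(\<Sum>j\<le>d. of_nat j * c j * g ^ (j - 1)) \<noteq> 0"
proof -
  define d where "d = (LEAST d. \<exists>c. annihilates d c g)"
  obtain c where c: "annihilates d c g"
    using LeastI_ex[of "\<lambda>d. \<exists>c. annihilates d c g"] assms unfolding d_def by blast
  have min: "\<not> annihilates k e g" if "k < d" for k e
    using not_less_Least that unfolding d_def by blast
  have fin: "finite {\<alpha>. cf (c j) \<alpha> \<noteq> 0}" if "j \<le> d" for j using c that by (auto simp: annihilates_def)
  have root: "(\<Sum>j\<le>d. c j * g ^ j) = 0" and nz: "\<exists>j\<le>d. c j \<noteq> 0" using c by (auto simp: annihilates_def)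
  have lead: "c d \<noteq> 0"
  proof
    assume "c d = 0"
    with nz obtain j where j: "j < d" "c j \<noteq> 0" by (metis le_neq_implies_less)
    then obtain k where k: "d = Suc k" by (cases d) auto
    have "annihilates k c g" using \<open>c d = 0\<close> root fin j unfolding annihilates_def k
      by (auto simp: less_Suc_eq_le)
    then show False using min k by blast
  qed
  have "d \<noteq> 0"
  proof
    assume "d = 0"
    with root lead show False by simp
  qed
  then obtain k where k: "d = Suc k" by (cases d) auto
  have "(\<Sum>j\<le>d. of_nat j * c j * g ^ (j - 1)) \<noteq> 0"
  proof
    assume D: "(\<Sum>j\<le>d. of_nat j * c j * g ^ (j - 1)) = 0"
    define e where "e j = of_nat (Suc j) * c (Suc j)" for j
    have "(\<Sum>j\<le>k. e j * g ^ j) = 0"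
      using D unfolding k e_def by (subst (asm) sum.atMost_Suc_shift) simp
    moreover have "finite {\<alpha>. cf (e j) \<alpha> \<noteq> 0}" if "j \<le> k" for j
      using that fin[of "Suc j"] k
      by (auto simp: e_def cf_of_nat_mult simp del: of_nat_Suc elim!: rev_finite_subset)
    ultimately have e0: "e j = 0" if "j \<le> k" for j
      using min[of k e] that k unfolding annihilates_def by auto
    have j0: "of_nat j = (0 :: 'b) \<or> c j = 0" if "j \<le> d" "j > 0" for j
    proof (rule disjCI)
      assume "c j \<noteq> 0"
      then obtain \<alpha> where "cf (c j) \<alpha> \<noteq> 0" using mps_eqI[of "c j" 0] by auto
      moreover have "of_nat j * cf (c j) \<alpha> = 0"
        using e0[of "j - 1"] that k cf_of_nat_mult[of j "c j" \<alpha>] by (auto simp: e_def)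
      ultimately show "of_nat j = (0 :: 'b)" by simp
    qed
    define p where "p = CHAR('b)"
    have dvd: "p dvd j \<or> c j = 0" if "j \<le> d" for j
      using j0[of j] that by (cases "j = 0") (auto simp: p_def of_nat_eq_0_iff_char_dvd)
    \<comment> \<open>In characteristic 0 this reads \<open>0 dvd d\<close> and contradicts
      \<open>d \<noteq> 0\<close>, so the characteristic is positive from here on.\<close>
    have "p dvd d" using dvd[of d] lead by simp
    then have "p > 0" using \<open>d \<noteq> 0\<close> by (auto intro: Nat.gr0I)
    then have p: "prime p" unfolding p_def by (rule prime_CHAR_semidom)
    obtain m where m: "d = p * m" using \<open>p dvd d\<close> by (auto elim: dvdE)
    have "(\<Sum>j\<le>m. c (p * j) * (g ^ j) ^ p) = (\<Sum>j\<in>(*) p ` {..m}. c j * g ^ j)"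
      using \<open>p > 0\<close> by (subst sum.reindex) (auto simp: inj_on_def mult.commute simp flip: power_mult)
    also have "\<dots> = (\<Sum>j\<le>d. c j * g ^ j)"
    proof (rule sum.mono_neutral_left)
      show "\<forall>j\<in>{..d} - (*) p ` {..m}. c j * g ^ j = 0"
      proof
        fix j assume j: "j \<in> {..d} - (*) p ` {..m}"
        have "\<not> p dvd j"
        proof
          assume "p dvd j"
          then obtain l where "j = p * l" by (auto elim: dvdE)
          then show False using j m \<open>p > 0\<close> by auto
        qed
        then show "c j * g ^ j = 0" using dvd[of j] j by simp
      qed
    qed (use m in auto)
    finally have "\<exists>e. annihilates m e g"
      using root lead m fin by (intro annihilates_CHAR[OF p p_def, of m "\<lambda>j. c (p * j)"]) auto
    moreover have "m < d" using m \<open>d \<noteq> 0\<close> prime_gt_1_nat[OF p] by simp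
    ultimately show False using min by blast
  qed
  with c show thesis by (rule that)
qed

section \<open>Finite generation of the coefficients\<close>

lemma alg_ps_annihilates:
  assumes "alg_ps J g" "finite J"
  obtains d c G where "annihilates d c G" "cf G = g"
proof -
  have fs: "finsupp \<alpha>" if "ps_in J h" "h \<alpha> \<noteq> 0" for \<alpha> and h :: "'a ps"
    using that assms(2) unfolding ps_in_def finsupp_def
    by (metis (mono_tags, lifting) finite_subset mem_Collect_eq subsetI)
  obtain d c where dc: "\<And>j. j \<le> d \<Longrightarrow> poly_in J (c j)" "\<exists>j\<le>d. c j \<noteq> ps_zero"
    "(\<lambda>\<alpha>. \<Sum>j\<le>d. ps_mult (c j) (ps_pow g j) \<alpha>) = ps_zero" and g: "ps_in J g"
    using assms(1) unfolding alg_ps_def by blast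
  define C where "C j = Mps (c j)" for j
  have G: "cf (Mps g) = g" using fs[OF g] by (simp add: Mps_inverse)
  have C: "cf (C j) = c j" if "j \<le> d" for j
    using fs[of "c j"] dc(1)[OF that] by (simp add: C_def Mps_inverse poly_in_def)
  have "(\<Sum>j\<le>d. C j * Mps g ^ j) = 0"
  proof (rule mps_eqI)
    fix \<alpha>
    have "cf (\<Sum>j\<le>d. C j * Mps g ^ j) \<alpha> = (\<Sum>j\<le>d. ps_mult (c j) (ps_pow g j) \<alpha>)"
      by (simp add: cf_sum times_mps.rep_eq cf_power C G)
    then show "cf (\<Sum>j\<le>d. C j * Mps g ^ j) \<alpha> = cf 0 \<alpha>"
      using fun_cong[OF dc(3), of \<alpha>] by (simp add: ps_zero_def)
  qed
  moreover have "\<exists>j\<le>d. C j \<noteq> 0"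
    using dc(2) C by (metis cf_zero ext ps_zero_def)
  ultimately have "annihilates d C (Mps g)"
    using dc(1) C unfolding annihilates_def poly_in_def by simp
  then show thesis using G by (rule that)
qed

theorem alg_ps_coefficients:
  fixes g :: "'b::field ps"
  assumes "alg_ps J g" "finite J"
  obtains A where "finite A" "\<And>R. subring R \<Longrightarrow> A \<subseteq> R \<Longrightarrow> range g \<subseteq> R"
proof -
  obtain d0 c0 G where "annihilates d0 c0 G" and G: "cf G = g"
    using alg_ps_annihilates[OF assms] .
  then obtain d c where c: "annihilates d c G" "(\<Sum>j\<le>d. of_nat j * c j * G ^ (j - 1)) \<noteq> 0"
    using separable_annihilator by blast
  define B where "B = (\<Union>j\<le>d. cf (c j) ` {\<alpha>. cf (c j) \<alpha> \<noteq> 0})"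
  obtain A where A: "finite A" "\<And>R. subring R \<Longrightarrow> A \<subseteq> R \<Longrightarrow> (\<forall>j\<le>d. \<forall>\<alpha>. cf (c j) \<alpha> \<in> R) \<Longrightarrow> (\<forall>\<alpha>. cf G \<alpha> \<in> R)"
    using coefficients_simple_root[OF _ c(2)] c(1) unfolding annihilates_def by metis
  show thesis
  proof (rule that[of "A \<union> B"])
    show "finite (A \<union> B)" using A(1) c(1) by (auto simp: B_def annihilates_def)
    show "range g \<subseteq> R" if R: "subring R" "A \<union> B \<subseteq> R" for R
    proof -
      have "cf (c j) \<alpha> \<in> R" if "j \<le> d" for j \<alpha>
        using R that by (cases "cf (c j) \<alpha> = 0") (auto simp: B_def subring_def)
      then show ?thesis using A(2)[of R] R G by auto
    qed
  qed
qed

section \<open>Specialising power series\<close>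

lemma subring_closed:
  assumes "subring R"
  shows "0 \<in> R" "1 \<in> R" "x \<in> R \<Longrightarrow> y \<in> R \<Longrightarrow> x + y \<in> R" "x \<in> R \<Longrightarrow> y \<in> R \<Longrightarrow> x * y \<in> R"
  using assms by (auto simp: subring_def)

context
  fixes R :: "'b::field set" and \<psi> :: "'b \<Rightarrow> 'a::field"
  assumes R: "subring R" and \<psi>: "ring_hom_on R \<psi>"
begin

lemma hom_on:
  shows "\<psi> 0 = 0" "\<psi> 1 = 1" "x \<in> R \<Longrightarrow> y \<in> R \<Longrightarrow> \<psi> (x + y) = \<psi> x + \<psi> y"
    "x \<in> R \<Longrightarrow> y \<in> R \<Longrightarrow> \<psi> (x * y) = \<psi> x * \<psi> y"
  using \<psi> by (auto simp: ring_hom_on_def)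

lemma hom_on_sum: "(\<And>x. x \<in> A \<Longrightarrow> g x \<in> R) \<Longrightarrow> \<psi> (sum g A) = (\<Sum>x\<in>A. \<psi> (g x))"
proof (induct A rule: infinite_finite_induct)
  case (insert x A)
  then show ?case by (simp add: hom_on subring_sum[OF R])
qed (auto simp: hom_on)

lemma hom_on_nonzero:
  assumes "x \<noteq> 0" "x \<in> R" "inverse x \<in> R"
  shows "\<psi> x \<noteq> 0"
  using hom_on(4)[OF assms(2,3)] assms(1) hom_on(2) by auto

lemma range_ps_mult:
  assumes "range g \<subseteq> R" "range h \<subseteq> R"
  shows "range (ps_mult g h) \<subseteq> R"
  using assms by (auto simp: ps_mult_def intro!: subring_sum[OF R] subring_closed[OF R])

lemma range_ps_one: "range ps_one \<subseteq> R"
  by (auto simp: ps_one_def subring_closed[OF R])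

lemma range_ps_pow: "range g \<subseteq> R \<Longrightarrow> range (ps_pow g k) \<subseteq> R"
  by (induct k) (simp_all add: range_ps_mult range_ps_one del: image_subset_iff)

lemma hom_on_ps_mult:
  assumes "range g \<subseteq> R" "range h \<subseteq> R"
  shows "\<psi> \<circ> ps_mult g h = ps_mult (\<psi> \<circ> g) (\<psi> \<circ> h)"
proof
  fix \<alpha>
  have "g \<beta> \<in> R" "h \<beta> \<in> R" for \<beta> using assms by auto
  then show "(\<psi> \<circ> ps_mult g h) \<alpha> = ps_mult (\<psi> \<circ> g) (\<psi> \<circ> h) \<alpha>"
    by (simp add: ps_mult_def hom_on_sum hom_on(4) subring_closed[OF R])
qed

lemma hom_on_ps_one: "\<psi> \<circ> ps_one = ps_one"
  by (auto simp: ps_one_def hom_on)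

lemma hom_on_ps_pow: "range g \<subseteq> R \<Longrightarrow> \<psi> \<circ> ps_pow g k = ps_pow (\<psi> \<circ> g) k"
proof (induct k)
  case 0 then show ?case using hom_on_ps_one by simp
next
  case (Suc k)
  then show ?case using hom_on_ps_mult[OF range_ps_pow[of g k], of g] unfolding ps_pow.simps by metis
qed

lemma hom_on_ps_mono_eval:
  assumes "\<And>i. i < length y \<Longrightarrow> range (y ! i) \<subseteq> R" "m \<le> length y"
  shows "range (ps_mono_eval m y \<beta>) \<subseteq> R \<and>
    \<psi> \<circ> ps_mono_eval m y \<beta> = ps_mono_eval m (map ((\<circ>) \<psi>) y) \<beta>"
  using assms(2)
proof (induct m)
  case 0 then show ?case using hom_on_ps_one range_ps_one by simp
next
  case (Suc m)
  have y: "range (y ! m) \<subseteq> R" using assms(1) Suc.prems by simp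
  have IH: "range (ps_mono_eval m y \<beta>) \<subseteq> R"
    "\<psi> \<circ> ps_mono_eval m y \<beta> = ps_mono_eval m (map ((\<circ>) \<psi>) y) \<beta>"
    using Suc by (blast dest: Suc_leD)+
  have "map ((\<circ>) \<psi>) y ! m = \<psi> \<circ> y ! m" using Suc.prems by simp
  then show ?case
    using range_ps_mult[OF IH(1) range_ps_pow[OF y, of "\<beta> m"]]
      hom_on_ps_mult[OF IH(1) range_ps_pow[OF y, of "\<beta> m"]] IH(2) hom_on_ps_pow[OF y]
    unfolding ps_mono_eval.simps by metis
qed

lemma hom_on_ypoly_eval:
  fixes \<phi> :: "'a \<Rightarrow> 'b"
  assumes \<phi>: "field_hom \<phi>" "\<And>c. \<phi> c \<in> R" "\<And>c. \<psi> (\<phi> c) = c"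
    and y: "\<And>i. i < length y \<Longrightarrow> range (y ! i) \<subseteq> R"
  shows "\<psi> \<circ> ypoly_eval (length y) (\<lambda>\<beta>. \<phi> \<circ> F \<beta>) y = ypoly_eval (length y) F (map ((\<circ>) \<psi>) y)"
proof
  fix \<alpha>
  \<comment> \<open>Each evaluation sums over the nonzero coefficients of its own polynomial;
    injectivity of \<phi> makes the two index sets equal.\<close>
  have zero_iff: "\<phi> \<circ> F \<beta> = ps_zero \<longleftrightarrow> F \<beta> = ps_zero" for \<beta>
    by (auto simp: ps_zero_def fun_eq_iff field_hom_eq_0_iff[OF \<phi>(1)])
  have coeff: "range (\<phi> \<circ> F \<beta>) \<subseteq> R" "\<psi> \<circ> (\<phi> \<circ> F \<beta>) = F \<beta>" for \<beta>
    using \<phi> by auto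
  define M where "M \<beta> = ps_mono_eval (length y) y \<beta>" for \<beta>
  define M' where "M' \<beta> = ps_mono_eval (length y) (map ((\<circ>) \<psi>) y) \<beta>" for \<beta>
  have mono: "range (M \<beta>) \<subseteq> R" "\<psi> \<circ> M \<beta> = M' \<beta>" for \<beta>
    unfolding M_def M'_def
    by (rule conjunct1[OF hom_on_ps_mono_eval] conjunct2[OF hom_on_ps_mono_eval], erule y, rule order_refl)+
  have "\<psi> \<circ> ps_mult (\<phi> \<circ> F \<beta>) (M \<beta>) = ps_mult (F \<beta>) (M' \<beta>)" for \<beta>
    using hom_on_ps_mult[OF coeff(1) mono(1), of \<beta> \<beta>] unfolding coeff(2) mono(2) .
  then have "\<psi> (ps_mult (\<phi> \<circ> F \<beta>) (M \<beta>) \<alpha>) = ps_mult (F \<beta>) (M' \<beta>) \<alpha>" for \<beta>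
    by (metis comp_apply)
  moreover have "ps_mult (\<phi> \<circ> F \<beta>) (M \<beta>) \<alpha> \<in> R" for \<beta>
    by (rule subsetD[OF range_ps_mult[OF coeff(1) mono(1)] rangeI])
  ultimately show "(\<psi> \<circ> ypoly_eval (length y) (\<lambda>\<beta>. \<phi> \<circ> F \<beta>) y) \<alpha> =
      ypoly_eval (length y) F (map ((\<circ>) \<psi>) y) \<alpha>"
    unfolding ypoly_eval_def zero_iff M_def[symmetric] M'_def[symmetric] by (simp add: hom_on_sum)
qed

end

text \<open>Specialisation can only shrink the support and so raise the order; one surviving
  exponent of least degree prevents this.\<close>

lemma ps_ord_eqI:
  assumes "\<And>\<alpha>. h \<alpha> \<noteq> 0 \<Longrightarrow> g \<alpha> \<noteq> 0"
    and "\<And>\<alpha>. g \<alpha> \<noteq> 0 \<Longrightarrow> \<exists>\<beta>. h \<beta> \<noteq> 0 \<and> (\<Sum>i<n. \<beta> i) \<le> (\<Sum>i<n. \<alpha> i)"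
  shows "ps_ord n h = ps_ord n g"
proof (cases "g = ps_zero")
  case True
  then have "h = ps_zero" using assms(1) by (auto simp: ps_zero_def)
  then show ?thesis using True by (simp add: ps_ord_def)
next
  case False
  let ?P = "\<lambda>g d. \<exists>\<alpha>. g \<alpha> \<noteq> 0 \<and> (\<Sum>i<n. \<alpha> i) = d"
  obtain \<alpha> where "g \<alpha> \<noteq> 0" using False by (auto simp: ps_zero_def)
  then have g: "?P g (Least (?P g))" using LeastI_ex[of "?P g"] by blast
  then obtain \<beta> where \<beta>: "h \<beta> \<noteq> 0" "(\<Sum>i<n. \<beta> i) \<le> Least (?P g)" using assms(2) by metis
  have h: "?P h (Least (?P h))" using \<beta> LeastI_ex[of "?P h"] by blast
  have "Least (?P h) \<le> (\<Sum>i<n. \<beta> i)" using \<beta>(1) by (intro Least_le) auto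
  moreover have "Least (?P g) \<le> Least (?P h)" using h assms(1) by (intro Least_le) blast
  ultimately have "Least (?P h) = Least (?P g)" using \<beta>(2) by linarith
  moreover have "h \<noteq> ps_zero" using \<beta> by (auto simp: ps_zero_def)
  ultimately show ?thesis using False by (simp add: ps_ord_def)
qed

lemma alg_ps_specialise:
  fixes g :: "'b::field ps"
  assumes "alg_ps J g" "finite J"
  obtains A where "finite A"
    "\<And>R (\<psi> :: 'b \<Rightarrow> 'a::field). subring R \<Longrightarrow> ring_hom_on R \<psi> \<Longrightarrow> A \<subseteq> R \<Longrightarrow>
       range g \<subseteq> R \<and> alg_ps J (\<psi> \<circ> g) \<and> ps_ord n (\<psi> \<circ> g) = ps_ord n g"
proof -
  obtain A0 where A0: "finite A0" "\<And>R. subring R \<Longrightarrow> A0 \<subseteq> R \<Longrightarrow> range g \<subseteq> R"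
    using alg_ps_coefficients[OF assms] by blast
  \<comment> \<open>The polynomial given by \<open>alg_ps\<close> is taken here instead of the
    separable one, because its coefficients involve only variables in \<open>J\<close>, which
    \<open>annihilates\<close> does not record.\<close>
  obtain d c j0 where c: "\<forall>j\<le>d. poly_in J (c j)" "j0 \<le> d" "c j0 \<noteq> ps_zero"
    "(\<lambda>\<alpha>. \<Sum>j\<le>d. ps_mult (c j) (ps_pow g j) \<alpha>) = ps_zero" and g: "ps_in J g"
    using assms(1) unfolding alg_ps_def by blast
  obtain \<gamma> where \<gamma>: "c j0 \<gamma> \<noteq> 0" using c(3) by (auto simp: ps_zero_def)
  \<comment> \<open>An exponent of least total degree in the support of \<open>g\<close>. For
    \<open>g = 0\<close> it is arbitrary, and \<open>inverse (g \<mu>)\<close> is 0.\<close>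
  define \<mu> where "\<mu> = arg_min (\<lambda>\<alpha>. \<Sum>i<n. \<alpha> i) (\<lambda>\<alpha>. g \<alpha> \<noteq> 0)"
  have \<mu>: "g \<mu> \<noteq> 0 \<and> (\<Sum>i<n. \<mu> i) \<le> (\<Sum>i<n. \<alpha> i)" if "g \<alpha> \<noteq> 0" for \<alpha>
    unfolding \<mu>_def using that
    by (metis (mono_tags, lifting) arg_min_nat_lemma)
  define A where "A = A0 \<union> (\<Union>j\<le>d. c j ` {\<alpha>. c j \<alpha> \<noteq> 0}) \<union> {inverse (c j0 \<gamma>), inverse (g \<mu>)}"
  show thesis
  proof (rule that[of A])
    show "finite A" using A0(1) c(1) by (auto simp: A_def poly_in_def)
    fix R and \<psi> :: "'b \<Rightarrow> 'a"
    assume R: "subring R" and \<psi>: "ring_hom_on R \<psi>" and A: "A \<subseteq> R"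
    have gR: "range g \<subseteq> R" using A0(2)[OF R] A by (simp add: A_def)
    have cR: "range (c j) \<subseteq> R" if "j \<le> d" for j
    proof
      fix x assume "x \<in> range (c j)"
      then show "x \<in> R" using A that subring_closed(1)[OF R] by (cases "x = 0") (auto simp: A_def)
    qed
    note \<psi>0 = hom_on(1)[OF R \<psi>]
    have "alg_ps J (\<psi> \<circ> g)"
      unfolding alg_ps_def
    proof (rule conjI, goal_cases in_J annihilator)
      case in_J
      show ?case using g \<psi>0 unfolding ps_in_def comp_def by metis
    next
      case annihilator
      have "poly_in J (\<psi> \<circ> c j)" if "j \<le> d" for j
      proof -
        have "{\<alpha>. (\<psi> \<circ> c j) \<alpha> \<noteq> 0} \<subseteq> {\<alpha>. c j \<alpha> \<noteq> 0}" using \<psi>0 by auto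
        then have "finite {\<alpha>. (\<psi> \<circ> c j) \<alpha> \<noteq> 0}"
          using c(1) that by (auto simp: poly_in_def intro: finite_subset)
        moreover have "ps_in J (\<psi> \<circ> c j)"
          using c(1) that \<psi>0 unfolding poly_in_def ps_in_def comp_def by metis
        ultimately show ?thesis by (simp add: poly_in_def)
      qed
      then have 1: "\<forall>j\<le>d. poly_in J (\<psi> \<circ> c j)" by blast
      have "\<psi> (c j0 \<gamma>) \<noteq> 0"
        using hom_on_nonzero[OF R \<psi> \<gamma>] cR[OF c(2)] A by (auto simp: A_def)
      then have "\<psi> \<circ> c j0 \<noteq> ps_zero" by (auto simp: ps_zero_def fun_eq_iff)
      then have 2: "\<exists>j\<le>d. \<psi> \<circ> c j \<noteq> ps_zero" using c(2) by blast
      have 3: "(\<lambda>\<alpha>. \<Sum>j\<le>d. ps_mult (\<psi> \<circ> c j) (ps_pow (\<psi> \<circ> g) j) \<alpha>) = ps_zero"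
      proof
        fix \<alpha>
        have "ps_mult (\<psi> \<circ> c j) (ps_pow (\<psi> \<circ> g) j) \<alpha> = \<psi> (ps_mult (c j) (ps_pow g j) \<alpha>)" if "j \<le> d" for j
          using hom_on_ps_mult[OF R \<psi> cR[OF that] range_ps_pow[OF R \<psi> gR, of j]]
            hom_on_ps_pow[OF R \<psi> gR, of j] by (metis comp_apply)
        then have "(\<Sum>j\<le>d. ps_mult (\<psi> \<circ> c j) (ps_pow (\<psi> \<circ> g) j) \<alpha>) =
            (\<Sum>j\<le>d. \<psi> (ps_mult (c j) (ps_pow g j) \<alpha>))" by simp
        also have "\<dots> = \<psi> (\<Sum>j\<le>d. ps_mult (c j) (ps_pow g j) \<alpha>)"
          using range_ps_mult[OF R \<psi> cR range_ps_pow[OF R \<psi> gR]]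
          by (intro hom_on_sum[OF R \<psi>, symmetric]) blast
        also have "\<dots> = 0" using fun_cong[OF c(4), of \<alpha>] \<psi>0 by (simp add: ps_zero_def)
        finally show "(\<Sum>j\<le>d. ps_mult (\<psi> \<circ> c j) (ps_pow (\<psi> \<circ> g) j) \<alpha>) = ps_zero \<alpha>"
          by (simp add: ps_zero_def)
      qed
      show ?case
        by (rule exI[of _ d], rule exI[of _ "\<lambda>j. \<psi> \<circ> c j"]) (intro conjI 1 2 3)
    qed
    moreover have "ps_ord n (\<psi> \<circ> g) = ps_ord n g"
    proof (rule ps_ord_eqI)
      show "g \<alpha> \<noteq> 0" if "(\<psi> \<circ> g) \<alpha> \<noteq> 0" for \<alpha> using that \<psi>0 by auto
      show "\<exists>\<beta>. (\<psi> \<circ> g) \<beta> \<noteq> 0 \<and> (\<Sum>i<n. \<beta> i) \<le> (\<Sum>i<n. \<alpha> i)" if "g \<alpha> \<noteq> 0" for \<alpha>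
        using \<mu>[OF that] hom_on_nonzero[OF R \<psi>, of "g \<mu>"] gR A
        by (intro exI[of _ \<mu>]) (auto simp: A_def)
    qed
    ultimately show "range g \<subseteq> R \<and> alg_ps J (\<psi> \<circ> g) \<and> ps_ord n (\<psi> \<circ> g) = ps_ord n g"
      using gR by blast
  qed
qed

theorem theorem2p1:
  fixes \<phi> :: "'a::field \<Rightarrow> 'b::field"
    and n p q :: nat
    and J :: "nat \<Rightarrow> nat set"
    and f :: "nat \<Rightarrow> (nat \<Rightarrow> nat) \<Rightarrow> 'a ps"
    and yh :: "'b ps list"
  assumes hom: "field_hom \<phi>"
    and pure: "alg_pure \<phi>"
    and J: "\<forall>i<p. J i \<subseteq> {..<n}"
    and f_poly: "\<forall>k<q. ypoly p (f k)"
    and f_coeff: "\<forall>k<q. \<forall>\<beta>. alg_ps {..<n} (f k \<beta>)"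
    and yh_len: "length yh = p"
    and yh_in: "\<forall>i<p. alg_ps (J i) (yh ! i)"
    and yh_sol: "\<forall>k<q. ypoly_eval p (\<lambda>\<beta>. \<phi> \<circ> f k \<beta>) yh = ps_zero"
  shows "\<exists>y :: 'a ps list. length y = p \<and> (\<forall>i<p. alg_ps (J i) (y ! i)) \<and>
           (\<forall>k<q. ypoly_eval p (f k) y = ps_zero) \<and>
           (\<forall>i<p. ps_ord n (y ! i) = ps_ord n (yh ! i))"
proof -
  have "\<exists>A. finite A \<and> (\<forall>R (\<psi> :: 'b \<Rightarrow> 'a). subring R \<longrightarrow> ring_hom_on R \<psi> \<longrightarrow> A \<subseteq> R \<longrightarrow>
      range (yh ! i) \<subseteq> R \<and> alg_ps (J i) (\<psi> \<circ> yh ! i) \<and> ps_ord n (\<psi> \<circ> yh ! i) = ps_ord n (yh ! i))"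
    if "i < p" for i
  proof -
    have "finite (J i)" using J that finite_subset by blast
    then show ?thesis using alg_ps_specialise[of "J i" "yh ! i" n] yh_in that by metis
  qed
  then obtain A where A: "\<And>i. i < p \<Longrightarrow> finite (A i)"
    "\<And>i R (\<psi> :: 'b \<Rightarrow> 'a). i < p \<Longrightarrow> subring R \<Longrightarrow> ring_hom_on R \<psi> \<Longrightarrow> A i \<subseteq> R \<Longrightarrow>
      range (yh ! i) \<subseteq> R \<and> alg_ps (J i) (\<psi> \<circ> yh ! i) \<and> ps_ord n (\<psi> \<circ> yh ! i) = ps_ord n (yh ! i)"
    by metis
  \<comment> \<open>The components of \<open>yh\<close> are tied together by the equations, so a
    single \<psi> must specialise them all.\<close>
  obtain R \<psi> where R: "(\<Union>i<p. A i) \<subseteq> R" "subring R" "ring_hom_on R \<psi>"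
    and \<psi>: "\<And>c. \<phi> c \<in> R" "\<And>c. \<psi> (\<phi> c) = c"
    using alg_pure_retraction[OF hom pure, of "\<Union>i<p. A i"] A(1) by (metis finite_UN finite_lessThan lessThan_iff)
  define y where "y = map ((\<circ>) \<psi>) yh"
  have yh: "range (yh ! i) \<subseteq> R \<and> alg_ps (J i) (y ! i) \<and> ps_ord n (y ! i) = ps_ord n (yh ! i)"
    if "i < p" for i
    using A(2)[OF that R(2,3)] R(1) that yh_len by (auto simp: y_def)
  have "ypoly_eval p (f k) y = ps_zero" if "k < q" for k
  proof -
    \<comment> \<open>As \<psi> inverts \<phi>, the system over K' specialises back to the original
      one.\<close>
    have "ypoly_eval p (f k) y = \<psi> \<circ> ypoly_eval p (\<lambda>\<beta>. \<phi> \<circ> f k \<beta>) yh"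
      using hom_on_ypoly_eval[OF R(2,3) hom \<psi>, of yh "f k"] yh yh_len by (simp add: y_def)
    then show ?thesis
      using yh_sol that hom_on(1)[OF R(2,3)] by (simp add: ps_zero_def comp_def)
  qed
  then show ?thesis using yh yh_len by (intro exI[of _ y]) (auto simp: y_def)
qed

end
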